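(* The Generic Method (GM) and the Bounded Entropy Method (BEM), both described in the context, are second-order consistent in space. That is, given a smooth solution $u(x,t)$ of problem $(P)$, with $u_i=u(i\Delta x,t)$ and $p_i=u_{i,\bar xx}-\mathcal{Z}_+(u_i)-\mathcal{Z}_-(u_i)$, the local truncation error $$\tau_i(t)=(1+\alpha u_i)\frac{du_i}{dt}+\big[m(u_{i-1},u_i)(1+p_{i,\bar x})\big]_x$$ is $O(\Delta x^2)$, where $m$ is the discrete mobility of the method considered (GM or BEM).
   Context: Let $L,T>0$, $\alpha\ge0$. The mobility $\mathcal{M}:[0,\infty)\to[0,\infty)$ is continuous, $C^4$ on $(0,\infty)$, with $\mathcal{M}(s)>0$ for $s>0$; $\mathcal{Z}_+,\mathcal{Z}_-\in C^2((0,\infty))$ with $\mathcal{Z}_+'\ge0$ and $\mathcal{Z}_-'\le0$. Problem $(P)$ is $$\frac{\partial}{\partial t}\Big(h+\frac{\alpha}{2}h^2\Big)+\frac{\partial}{\partial x}\Big[\mathcal{M}(h)\Big(1+\frac{\partial p}{\partial x}\Big)\Big]=0\quad\text{in }(0,L)\times(0,T),\qquad p=\frac{\partial^2h}{\partial x^2}-\mathcal{Z}_+(h)-\mathcal{Z}_-(h),$$ with periodic boundary conditions on $[0,L]$ and initial condition $h(x,0)=h_0(x)>0$. Solutions of $(P)$ are understood to be positive. Grid: $\Delta x=L/N$ with $N$ a positive integer; grid functions are periodic in the index, $v_{i+N}=v_i$. Finite differences: $$v_{i,x}=\frac{v_{i+1}-v_i}{\Delta x},\qquad v_{i,\bar x}=\frac{v_i-v_{i-1}}{\Delta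 x},\qquad v_{i,\bar xx}=\frac{v_{i+1,\bar x}-v_{i,\bar x}}{\Delta x},$$ and $[w_i]_x=(w_{i+1}-w_i)/\Delta x$ for any grid expression $w_i$. Both methods are continuous in time, discrete in space, and have the form $$(1+\alpha u_i)\frac{du_i}{dt}+\big[m(u_{i-1},u_i)(1+p_{i,\bar x})\big]_x=0,\qquad p_i=u_{i,\bar xx}-\mathcal{Z}_+(u_i)-\mathcal{Z}_-(u_i),\qquad u_i(0)=u_0(i\Delta x),$$ where $u_0$ is the given initial function; they differ in the discrete mobility $m$. GM: $m$ is a function satisfying (a) $m(s,s)=\mathcal{M}(s)$; (b) $m(s_1,s_2)=m(s_2,s_1)$; (c) $m\in C^4((0,\infty)\times(0,\infty))\cap C([0,\infty)\times[0,\infty))$; (d) for every $\delta>0$ there exists $\gamma>0$ such that $s_1,s_2>\delta$ implies $m(s_1,s_2)\ge\gamma>0$. BEM: $m(s_1,s_2)=\mathcal{M}(s_1)$ if $s_1=s_2$, and $m(s_1,s_2)=(s_2-s_1)\big/\int_{s_1}^{s_2}\frac{1}{\mathcal{M}(s)}\,ds$ if $s_1\ne s_2$. *)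

theory Defs
  imports "HOL-Analysis.Analysis"
begin

section \<open>Regularity\<close>

text \<open>\<open>C_k_on k f S\<close> is meant for open \<open>S\<close> in a Euclidean space, where continuity of all
  directional derivatives of order \<open>k\<close> is the usual continuity of the \<open>k\<close>-th derivative.\<close>

fun C_k_on :: "nat \<Rightarrow> ('a::euclidean_space \<Rightarrow> real) \<Rightarrow> 'a set \<Rightarrow> bool" where
  "C_k_on 0 f S \<longleftrightarrow> continuous_on S f"
| "C_k_on (Suc k) f S \<longleftrightarrow>
     (\<forall>x\<in>S. f differentiable (at x)) \<and>
     (\<forall>v. C_k_on k (\<lambda>x. frechet_derivative f (at x) v) S)"

text \<open>Functions \<open>v x t\<close> on \<open>\<real> \<times> [0,T]\<close> with \<open>k\<close> space derivatives, jointly continuous up to the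
  times \<open>0\<close> and \<open>T\<close>.\<close>

definition C_k_space :: "nat \<Rightarrow> real \<Rightarrow> (real \<Rightarrow> real \<Rightarrow> real) \<Rightarrow> bool" where
  "C_k_space k T v \<longleftrightarrow>
     (\<forall>j<k. \<forall>t\<in>{0..T}. \<forall>x. (deriv ^^ j) (\<lambda>y. v y t) differentiable (at x)) \<and>
     (\<forall>j\<le>k. continuous_on (UNIV \<times> {0..T}) (\<lambda>(x, t). (deriv ^^ j) (\<lambda>y. v y t) x))"

text \<open>The smoothness asked of a solution: six space derivatives of \<open>u\<close>, and a time derivative with
  two space derivatives, all continuous on \<open>\<real> \<times> [0,T]\<close>. Every \<open>C\<^sup>\<infinity>\<close> function on \<open>\<real> \<times> [0,T]\<close>
  qualifies; full \<open>C\<^sup>\<infinity>\<close> regularity is not to be expected of solutions when the mobility is only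
  \<open>C\<^sup>4\<close>.\<close>

definition smooth_spacetime :: "real \<Rightarrow> (real \<Rightarrow> real \<Rightarrow> real) \<Rightarrow> bool" where
  "smooth_spacetime T u \<longleftrightarrow>
     C_k_space 6 T u \<and>
     (\<exists>ut. C_k_space 2 T ut \<and>
        (\<forall>x. \<forall>t\<in>{0..T}. ((\<lambda>s. u x s) has_real_derivative ut x t) (at t within {0..T})))"


section \<open>The continuous problem\<close>

definition pressure ::
    "(real \<Rightarrow> real) \<Rightarrow> (real \<Rightarrow> real) \<Rightarrow> (real \<Rightarrow> real \<Rightarrow> real) \<Rightarrow> real \<Rightarrow> real \<Rightarrow> real" where
  "pressure Zp Zm h x t =
     (deriv ^^ 2) (\<lambda>y. h y t) x - Zp (h x t) - Zm (h x t)"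

text \<open>A positive, smooth solution of problem \<open>(P)\<close>. The periodic boundary conditions are expressed
  by taking \<open>h\<close> to be a smooth \<open>L\<close>-periodic function on the whole line. For \<open>C\<^sup>2\<close> functions
  \<open>Zp\<close>, \<open>Zm\<close> and a \<open>C\<^sup>1\<close> mobility on \<open>(0,\<infinity>)\<close> the smoothness makes \<open>deriv\<close> in the
  differential equation a genuine derivative.\<close>

definition smooth_solution_P ::
    "real \<Rightarrow> real \<Rightarrow> real \<Rightarrow> (real \<Rightarrow> real) \<Rightarrow> (real \<Rightarrow> real) \<Rightarrow> (real \<Rightarrow> real) \<Rightarrow>
     (real \<Rightarrow> real) \<Rightarrow> (real \<Rightarrow> real \<Rightarrow> real) \<Rightarrow> bool" where
  "smooth_solution_P L T \<alpha> M Zp Zm h0 h \<longleftrightarrow>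
     smooth_spacetime T h \<and>
     (\<forall>x. \<forall>t\<in>{0..T}. h (x + L) t = h x t) \<and>
     (\<forall>x. \<forall>t\<in>{0..T}. h x t > 0) \<and>
     (\<forall>x. h x 0 = h0 x) \<and>
     (\<forall>x\<in>{0<..<L}. \<forall>t\<in>{0<..<T}.
        deriv (\<lambda>s. h x s + \<alpha> / 2 * (h x s)\<^sup>2) t
        + deriv (\<lambda>y. M (h y t) * (1 + deriv (\<lambda>z. pressure Zp Zm h z t) y)) x = 0)"


section \<open>The semi-discrete methods\<close>

definition fwd_diff :: "real \<Rightarrow> (int \<Rightarrow> real) \<Rightarrow> int \<Rightarrow> real" where
  "fwd_diff dx v i = (v (i + 1) - v i) / dx"

definition bwd_diff :: "real \<Rightarrow> (int \<Rightarrow> real) \<Rightarrow> int \<Rightarrow> real" where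
  "bwd_diff dx v i = (v i - v (i - 1)) / dx"

definition discrete_pressure ::
    "(real \<Rightarrow> real) \<Rightarrow> (real \<Rightarrow> real) \<Rightarrow> real \<Rightarrow> (int \<Rightarrow> real) \<Rightarrow> int \<Rightarrow> real" where
  "discrete_pressure Zp Zm dx v i =
     fwd_diff dx (bwd_diff dx v) i - Zp (v i) - Zm (v i)"

text \<open>The left-hand side of the semi-discrete scheme with discrete mobility \<open>m\<close>, for a
  time-dependent grid function \<open>w i t\<close>; the scheme itself is the requirement that it vanish.\<close>

definition scheme_residual ::
    "real \<Rightarrow> (real \<Rightarrow> real) \<Rightarrow> (real \<Rightarrow> real) \<Rightarrow> (real \<Rightarrow> real \<Rightarrow> real) \<Rightarrow> real \<Rightarrow>
     (int \<Rightarrow> real \<Rightarrow> real) \<Rightarrow> int \<Rightarrow> real \<Rightarrow> real" where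
  "scheme_residual \<alpha> Zp Zm m dx w i t =
     (1 + \<alpha> * w i t) * deriv (\<lambda>s. w i s) t
     + fwd_diff dx
         (\<lambda>j. m (w (j - 1) t) (w j t)
              * (1 + bwd_diff dx (discrete_pressure Zp Zm dx (\<lambda>l. w l t)) j)) i"

definition truncation_error ::
    "real \<Rightarrow> (real \<Rightarrow> real) \<Rightarrow> (real \<Rightarrow> real) \<Rightarrow> (real \<Rightarrow> real \<Rightarrow> real) \<Rightarrow> real \<Rightarrow>
     (real \<Rightarrow> real \<Rightarrow> real) \<Rightarrow> int \<Rightarrow> real \<Rightarrow> real" where
  "truncation_error \<alpha> Zp Zm m dx u i t =
     scheme_residual \<alpha> Zp Zm m dx (\<lambda>j s. u (of_int j * dx) s) i t"

definition GM_mobility :: "(real \<Rightarrow> real) \<Rightarrow> (real \<Rightarrow> real \<Rightarrow> real) \<Rightarrow> bool" where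
  "GM_mobility M m \<longleftrightarrow>
     (\<forall>s\<ge>0. m s s = M s) \<and>
     (\<forall>s1\<ge>0. \<forall>s2\<ge>0. m s1 s2 = m s2 s1) \<and>
     C_k_on 4 (\<lambda>(s1, s2). m s1 s2) ({0<..} \<times> {0<..}) \<and>
     continuous_on ({0..} \<times> {0..}) (\<lambda>(s1, s2). m s1 s2) \<and>
     (\<forall>\<delta>>0. \<exists>\<gamma>>0. \<forall>s1>\<delta>. \<forall>s2>\<delta>. m s1 s2 \<ge> \<gamma>)"

text \<open>\<open>LBINT\<close> is the oriented integral, so \<open>s2 < s1\<close> is covered.\<close>

definition BEM_mobility :: "(real \<Rightarrow> real) \<Rightarrow> real \<Rightarrow> real \<Rightarrow> real" where
  "BEM_mobility M s1 s2 =
     (if s1 = s2 then M s1 else (s2 - s1) / (LBINT s=s1..s2. 1 / M s))"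

text \<open>Second-order consistency in space along \<open>u\<close>: the constant is uniform in the grid, the grid
  point and the time.\<close>

definition second_order_consistent ::
    "real \<Rightarrow> real \<Rightarrow> real \<Rightarrow> (real \<Rightarrow> real) \<Rightarrow> (real \<Rightarrow> real) \<Rightarrow> (real \<Rightarrow> real \<Rightarrow> real) \<Rightarrow>
     (real \<Rightarrow> real \<Rightarrow> real) \<Rightarrow> bool" where
  "second_order_consistent L T \<alpha> Zp Zm m u \<longleftrightarrow>
     (\<exists>C. \<forall>N::nat. N > 0 \<longrightarrow> (\<forall>i. \<forall>t\<in>{0<..<T}.
        \<bar>truncation_error \<alpha> Zp Zm m (L / real N) u i t\<bar> \<le> C * (L / real N)\<^sup>2))"

end

theory Submission
  imports Defs
begin

text \<open>Let \<open>h\<close> be the mesh width and \<open>F = M(u) (1 + p\<^sub>x)\<close> the exact flux. A truncation error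
  contains a difference quotient of the discrete flux, so it does not suffice that the discrete
  flux is within \<open>O(h\<^sup>2)\<close> of \<open>F\<close>. What makes the methods second order is that the discrete flux,
  read as a function of a continuous variable \<open>y\<close>, is \<open>F + h\<^sup>2 r\<close> with \<open>r\<close> \<^emph>\<open>and its space
  derivative\<close> bounded uniformly in \<open>h\<close> and \<open>t\<close>. Its central difference is then
  \<open>F\<^sub>x + O(h\<^sup>2)\<close>, because \<open>F\<close> is \<open>C\<^sup>3\<close>, plus \<open>h\<^sup>2\<close> times a difference quotient of \<open>r\<close>, which the
  mean value theorem bounds. Adding \<open>(1 + \<alpha> u) u\<^sub>t = - F\<^sub>x\<close> leaves \<open>O(h\<^sup>2)\<close>. The predicate
  \<open>bounded_derivs\<close> is the bookkeeping for such uniform bounds; its closure properties, and the fact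
  that central differences commute with differentiation, reduce every estimate to the mean value
  theorem.

  The regularity of the pressure comes from the equation. As \<open>Zp\<close> and \<open>Zm\<close> are only \<open>C\<^sup>2\<close>, the
  pressure is a priori only \<open>C\<^sup>2\<close> in \<open>x\<close>, whereas \<open>r\<^sub>y\<close> involves its fourth derivative. But
  \<open>F\<^sub>x = - (1 + \<alpha> u) u\<^sub>t\<close> is \<open>C\<^sup>2\<close>, so \<open>F\<close> is \<open>C\<^sup>3\<close>, and so is \<open>p\<^sub>x = F / M(u) - 1\<close>.

  The discrete mobility enters through one property, \<open>midpoint_accurate\<close>: in the mean \<open>\<sigma>\<close> and the
  half difference \<open>\<rho>\<close> of its arguments, \<open>m\<close> agrees with \<open>M(\<sigma>)\<close> up to \<open>O(\<rho>\<^sup>2)\<close>, also after one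
  differentiation. By \<open>midpoint_accurate_expansion\<close> this gives
  \<open>m(u(y - h/2), u(y + h/2)) = M(u(y)) + h\<^sup>2 e\<close> with \<open>e\<close> and \<open>e\<^sub>y\<close> bounded. For the Generic Method
  the property holds because a symmetric \<open>m\<close> is even in \<open>\<rho>\<close>; for the Bounded Entropy Method because
  \<open>1/m\<close> is the average of \<open>1/M\<close> over the segment between the arguments, and the linear Taylor term
  about the midpoint averages to zero.\<close>

section \<open>Families of functions with uniformly bounded derivatives\<close>

text \<open>The index is the time, and later the pair of mesh width and time; \<open>K\<close> may not depend on it.
  Existence and boundedness of the derivatives, without continuity of the last one, is what the mean
  value theorem consumes and what can be verified for remainders divided by \<open>h\<^sup>2\<close>.\<close>

fun bounded_derivs :: "nat \<Rightarrow> 'i set \<Rightarrow> ('i \<Rightarrow> real \<Rightarrow> real) \<Rightarrow> bool" where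
  "bounded_derivs 0 I f \<longleftrightarrow> (\<exists>K. \<forall>i\<in>I. \<forall>x. \<bar>f i x\<bar> \<le> K)"
| "bounded_derivs (Suc k) I f \<longleftrightarrow>
     (\<exists>K. \<forall>i\<in>I. \<forall>x. \<bar>f i x\<bar> \<le> K) \<and>
     (\<exists>f'. (\<forall>i\<in>I. \<forall>x. (f i has_real_derivative f' i x) (at x)) \<and> bounded_derivs k I f')"

lemma bounded_derivs_bound:
  assumes "bounded_derivs k I f"
  obtains K where "K \<ge> 0" "\<And>i x. i \<in> I \<Longrightarrow> \<bar>f i x\<bar> \<le> K"
proof -
  obtain K where "\<forall>i\<in>I. \<forall>x. \<bar>f i x\<bar> \<le> K"
    using assms by (cases k) auto
  then show ?thesis
    by (intro that[of "max K 0"]) (auto simp: le_max_iff_disj)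
qed

lemma bounded_derivs_cong:
  assumes "bounded_derivs k I f" and "\<And>i x. i \<in> I \<Longrightarrow> f i x = g i x"
  shows "bounded_derivs k I g"
proof -
  have eq: "f i = g i" if "i \<in> I" for i
    using assms(2) that by blast
  show ?thesis
    using assms(1) by (cases k) (auto simp: eq)
qed

lemma bounded_derivs_SucI:
  assumes "bounded_derivs k' I f"
    and "\<And>i x. i \<in> I \<Longrightarrow> (f i has_real_derivative f' i x) (at x)"
    and "bounded_derivs k I f'"
  shows "bounded_derivs (Suc k) I f"
proof -
  obtain K where "\<And>i x. i \<in> I \<Longrightarrow> \<bar>f i x\<bar> \<le> K"
    using bounded_derivs_bound[OF assms(1)] by metis
  then show ?thesis
    unfolding bounded_derivs.simps
    by (intro conjI exI[of _ f'] exI[of _ K] ballI allI assms(2,3))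
qed

lemma bounded_derivs_pred: "bounded_derivs (Suc k) I f \<Longrightarrow> bounded_derivs k I f"
  by (induction k arbitrary: f) auto

lemma bounded_derivs_mono:
  assumes "bounded_derivs l I f" and "k \<le> l"
  shows "bounded_derivs k I f"
  using assms(2,1) by (induction rule: dec_induct) (blast dest: bounded_derivs_pred)+

lemma bounded_derivs_reindex:
  assumes "bounded_derivs k I f" and "\<And>j. j \<in> J \<Longrightarrow> g j \<in> I"
  shows "bounded_derivs k J (\<lambda>j. f (g j))"
  using assms(1)
proof (induction k arbitrary: f)
  case 0
  then show ?case using assms(2) by auto
next
  case (Suc k)
  from Suc.prems obtain f' where f': "\<And>i x. i \<in> I \<Longrightarrow> (f i has_real_derivative f' i x) (at x)"
    and "bounded_derivs k I f'"
    unfolding bounded_derivs.simps by metis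
  have "bounded_derivs 0 J (\<lambda>j. f (g j))"
    using Suc.prems assms(2) by auto
  then show ?case
    by (rule bounded_derivs_SucI[where f' = "\<lambda>j. f' (g j)"])
      (use f' Suc.IH[OF \<open>bounded_derivs k I f'\<close>] assms(2) in auto)
qed

lemma bounded_derivs_const:
  assumes "\<And>i. i \<in> I \<Longrightarrow> \<bar>c i\<bar> \<le> K"
  shows "bounded_derivs k I (\<lambda>i x. c i)"
  using assms
proof (induction k arbitrary: c K)
  case 0
  then show ?case by auto
next
  case (Suc k)
  show ?case
    by (rule bounded_derivs_SucI[where f' = "\<lambda>i x. 0" and k' = 0])
      (use Suc.prems Suc.IH[of "\<lambda>i. 0" 0] in auto)
qed

lemma bounded_derivs_add:
  assumes "bounded_derivs k I f" and "bounded_derivs k I g"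
  shows "bounded_derivs k I (\<lambda>i x. f i x + g i x)"
  using assms
proof (induction k arbitrary: f g)
  case 0
  then obtain K1 K2 where "\<forall>i\<in>I. \<forall>x. \<bar>f i x\<bar> \<le> K1" "\<forall>i\<in>I. \<forall>x. \<bar>g i x\<bar> \<le> K2"
    by auto
  then have "\<forall>i\<in>I. \<forall>x. \<bar>f i x + g i x\<bar> \<le> K1 + K2"
    by (meson abs_triangle_ineq add_mono order_trans)
  then show ?case by auto
next
  case (Suc k)
  obtain f' where f': "\<And>i x. i \<in> I \<Longrightarrow> (f i has_real_derivative f' i x) (at x)"
      "bounded_derivs k I f'"
    using Suc.prems(1) unfolding bounded_derivs.simps by metis
  obtain g' where g': "\<And>i x. i \<in> I \<Longrightarrow> (g i has_real_derivative g' i x) (at x)"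
      "bounded_derivs k I g'"
    using Suc.prems(2) unfolding bounded_derivs.simps by metis
  have "bounded_derivs k I (\<lambda>i x. f i x + g i x)"
    by (rule Suc.IH[OF Suc.prems[THEN bounded_derivs_pred]])
  then show ?case
    by (rule bounded_derivs_SucI[where f' = "\<lambda>i x. f' i x + g' i x"])
      (auto intro!: derivative_eq_intros f' g' Suc.IH)
qed

lemma bounded_derivs_mult:
  assumes "bounded_derivs k I f" and "bounded_derivs k I g"
  shows "bounded_derivs k I (\<lambda>i x. f i x * g i x)"
  using assms
proof (induction k arbitrary: f g)
  case 0
  obtain K1 where K1: "K1 \<ge> 0" "\<And>i x. i \<in> I \<Longrightarrow> \<bar>f i x\<bar> \<le> K1"
    using bounded_derivs_bound[OF 0(1)] by metis
  obtain K2 where K2: "K2 \<ge> 0" "\<And>i x. i \<in> I \<Longrightarrow> \<bar>g i x\<bar> \<le> K2"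
    using bounded_derivs_bound[OF 0(2)] by metis
  have "\<forall>i\<in>I. \<forall>x. \<bar>f i x * g i x\<bar> \<le> K1 * K2"
    using K1 K2 by (simp add: abs_mult mult_mono)
  then show ?case by auto
next
  case (Suc k)
  obtain f' where f': "\<And>i x. i \<in> I \<Longrightarrow> (f i has_real_derivative f' i x) (at x)"
      "bounded_derivs k I f'"
    using Suc.prems(1) unfolding bounded_derivs.simps by metis
  obtain g' where g': "\<And>i x. i \<in> I \<Longrightarrow> (g i has_real_derivative g' i x) (at x)"
      "bounded_derivs k I g'"
    using Suc.prems(2) unfolding bounded_derivs.simps by metis
  have "bounded_derivs k I f" "bounded_derivs k I g"
    by (rule Suc.prems[THEN bounded_derivs_pred])+
  then have "bounded_derivs k I (\<lambda>i x. f' i x * g i x + f i x * g' i x)"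
      "bounded_derivs k I (\<lambda>i x. f i x * g i x)"
    using f' g' by (auto intro: Suc.IH bounded_derivs_add)
  then show ?case
    by (intro bounded_derivs_SucI[where f' = "\<lambda>i x. f' i x * g i x + f i x * g' i x"])
      (auto intro!: derivative_eq_intros f' g')
qed

lemma bounded_derivs_cmult:
  "bounded_derivs k I f \<Longrightarrow> bounded_derivs k I (\<lambda>i x. c * f i x)"
  by (rule bounded_derivs_mult[OF bounded_derivs_const[of _ "\<lambda>i. c" "\<bar>c\<bar>"]]) auto

lemma bounded_derivs_diff:
  assumes "bounded_derivs k I f" and "bounded_derivs k I g"
  shows "bounded_derivs k I (\<lambda>i x. f i x - g i x)"
  using bounded_derivs_add[OF assms(1) bounded_derivs_cmult[OF assms(2), of "-1"]] by simp

lemma bounded_derivs_inverse: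
  assumes "bounded_derivs k I f" and "c > 0" and "\<And>i x. i \<in> I \<Longrightarrow> c \<le> f i x"
  shows "bounded_derivs k I (\<lambda>i x. 1 / f i x)"
  using assms(1)
proof (induction k)
  case 0
  have "\<bar>1 / f i x\<bar> \<le> 1 / c" if "i \<in> I" for i x
    using assms(2) assms(3)[OF that, of x] by (simp add: frac_le)
  then show ?case by auto
next
  case (Suc k)
  obtain f' where f': "\<And>i x. i \<in> I \<Longrightarrow> (f i has_real_derivative f' i x) (at x)"
      "bounded_derivs k I f'"
    using Suc.prems unfolding bounded_derivs.simps by metis
  have inv: "bounded_derivs k I (\<lambda>i x. 1 / f i x)"
    by (rule Suc.IH[OF bounded_derivs_pred[OF Suc.prems]])
  have "bounded_derivs k I (\<lambda>i x. - 1 * (f' i x * (1 / f i x * (1 / f i x))))"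
    by (intro bounded_derivs_cmult bounded_derivs_mult inv f')
  moreover have "((\<lambda>x. 1 / f i x) has_real_derivative
      - 1 * (f' i x * (1 / f i x * (1 / f i x)))) (at x)" if "i \<in> I" for i x
  proof -
    have "f i x \<noteq> 0" using assms(2) assms(3)[OF that, of x] by auto
    then show ?thesis
      by (auto intro!: derivative_eq_intros f' that simp: field_simps)
  qed
  ultimately show ?case
    by (intro bounded_derivs_SucI[OF inv])
qed

lemma C_k_on_imp_continuous_on: "C_k_on k f S \<Longrightarrow> continuous_on S f"
  by (cases k) (auto intro!: continuous_at_imp_continuous_on differentiable_imp_continuous_within)

lemma C_k_on_real_deriv:
  fixes f :: "real \<Rightarrow> real"
  assumes "C_k_on (Suc k) f S"
  obtains f' where "\<And>x. x \<in> S \<Longrightarrow> (f has_real_derivative f' x) (at x)" and "C_k_on k f' S"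
proof (rule that)
  show "C_k_on k (\<lambda>x. frechet_derivative f (at x) 1) S"
    using assms by simp
  fix x assume "x \<in> S"
  then have "(f has_derivative frechet_derivative f (at x)) (at x)"
    using assms by (simp add: frechet_derivative_works)
  moreover have "frechet_derivative f (at x) = (*) (frechet_derivative f (at x) 1)"
  proof
    fix r
    show "frechet_derivative f (at x) r = frechet_derivative f (at x) 1 * r"
      using linear_scale[OF has_derivative_linear[OF calculation], of r 1] by simp
  qed
  ultimately show "(f has_real_derivative frechet_derivative f (at x) 1) (at x)"
    by (metis has_field_derivative_def)
qed

lemma continuous_bounded_on:
  fixes f :: "'a::topological_space \<Rightarrow> real"
  assumes "continuous_on S f" and "compact C" and "C \<subseteq> S"
  obtains K where "K \<ge> 0" "\<And>x. x \<in> C \<Longrightarrow> \<bar>f x\<bar> \<le> K"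
proof -
  have "bounded (f ` C)"
    using assms by (meson compact_continuous_image compact_imp_bounded continuous_on_subset)
  then obtain B where "B > 0" "\<And>x. x \<in> C \<Longrightarrow> \<bar>f x\<bar> \<le> B"
    by (auto simp: bounded_pos)
  then show ?thesis
    using that[of B] by simp
qed

lemma continuous_positive_bound:
  fixes f :: "'a::topological_space \<Rightarrow> real"
  assumes "continuous_on S f" and "compact C" and "C \<subseteq> S" and "\<And>x. x \<in> C \<Longrightarrow> f x > 0"
  obtains c where "c > 0" "\<And>x. x \<in> C \<Longrightarrow> c \<le> f x"
proof (cases "C = {}")
  case True
  then show ?thesis using that[of 1] by simp
next
  case False
  then obtain x where "x \<in> C" "\<And>y. y \<in> C \<Longrightarrow> f x \<le> f y"
    using continuous_attains_inf[OF assms(2) _ continuous_on_subset[OF assms(1,3)]] by blast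
  then show ?thesis using that[of "f x"] assms(4) by blast
qed

text \<open>\<open>g\<close> may be singular at \<open>0\<close>; it is the compact range \<open>{a..b}\<close>, away from \<open>0\<close>, that makes the
  bounds on its derivatives uniform.\<close>

lemma bounded_derivs_compose:
  assumes "C_k_on k g {0<..}" and "bounded_derivs k I f" and "a > 0"
    and "\<And>i x. i \<in> I \<Longrightarrow> f i x \<in> {a..b}"
  shows "bounded_derivs k I (\<lambda>i x. g (f i x))"
proof -
  have sub: "{a..b} \<subseteq> {0<..}"
    using assms(3) by auto
  have bounded: "bounded_derivs 0 I (\<lambda>i x. g (f i x))" if C_k: "C_k_on l g {0<..}" for l and g :: "real \<Rightarrow> real"
  proof -
    obtain K where K: "\<And>s. s \<in> {a..b} \<Longrightarrow> \<bar>g s\<bar> \<le> K"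
      using continuous_bounded_on[OF C_k_on_imp_continuous_on[OF C_k] compact_Icc sub] by metis
    then show ?thesis
      unfolding bounded_derivs.simps by (intro exI[of _ K] ballI allI K assms(4))
  qed
  show ?thesis
    using assms(1,2)
  proof (induction k arbitrary: g)
    case 0
    then show ?case
      using bounded by blast
  next
    case (Suc k)
    obtain g' where g': "\<And>s. s \<in> {0<..} \<Longrightarrow> (g has_real_derivative g' s) (at s)" "C_k_on k g' {0<..}"
      using C_k_on_real_deriv[OF Suc.prems(1)] by metis
    obtain f' where f': "\<And>i x. i \<in> I \<Longrightarrow> (f i has_real_derivative f' i x) (at x)"
        "bounded_derivs k I f'"
      using Suc.prems(2) unfolding bounded_derivs.simps by metis
    have m: "bounded_derivs k I (\<lambda>i x. g' (f i x) * f' i x)"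
      by (rule bounded_derivs_mult[OF Suc.IH[OF g'(2) bounded_derivs_pred[OF Suc.prems(2)]] f'(2)])
    have d: "((\<lambda>x. g (f i x)) has_real_derivative g' (f i x) * f' i x) (at x)" if "i \<in> I" for i x
      using sub assms(4)[OF that] by (intro DERIV_chain2[OF g'(1) f'(1)[OF that]]) blast
    show ?case
      by (rule bounded_derivs_SucI[OF bounded[OF Suc.prems(1)] d m])
  qed
qed

section \<open>Central differences\<close>

text \<open>A substitute for Taylor's theorem without the sharp factorials: applied repeatedly, it turns a bound
  on the last derivative into the right power of the step.\<close>

lemma abs_le_power_of_deriv:
  fixes \<phi> :: "real \<Rightarrow> real"
  assumes "k \<ge> 0" and "C \<ge> 0" and "\<phi> 0 = 0"
    and "\<And>s. s \<in> {0..k} \<Longrightarrow> (\<phi> has_real_derivative \<phi>' s) (at s)"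
    and "\<And>s. s \<in> {0..k} \<Longrightarrow> \<bar>\<phi>' s\<bar> \<le> C * s ^ n"
  shows "\<bar>\<phi> k\<bar> \<le> C * k ^ Suc n"
proof (cases "k = 0")
  case True
  then show ?thesis using assms(3) by simp
next
  case False
  then obtain z where z: "0 < z" "z < k" "\<phi> k - \<phi> 0 = (k - 0) * \<phi>' z"
    using MVT2[of 0 k \<phi> \<phi>'] assms(1,4) by (metis atLeastAtMost_iff order_le_less)
  have "\<bar>\<phi>' z\<bar> \<le> C * z ^ n"
    using z assms(5) by auto
  also have "\<dots> \<le> C * k ^ n"
    using z assms(2) by (intro mult_left_mono power_mono) auto
  finally have "k * \<bar>\<phi>' z\<bar> \<le> k * (C * k ^ n)"
    using assms(1) by (rule mult_left_mono)
  then show ?thesis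
    using z assms(1,3) by (simp add: abs_mult algebra_simps)
qed

text \<open>The first-order terms on the two sides cancel. The hypotheses are local because the lemma is also
  applied inside a box on which the mobility is controlled.\<close>

lemma average_error:
  fixes f :: "real \<Rightarrow> real"
  assumes "k \<ge> 0" and "K \<ge> 0"
    and "\<And>s. s \<in> {x - k..x + k} \<Longrightarrow> (f has_real_derivative f' s) (at s)"
    and "\<And>s. s \<in> {x - k..x + k} \<Longrightarrow> (f' has_real_derivative f'' s) (at s)"
    and "\<And>s. s \<in> {x - k..x + k} \<Longrightarrow> \<bar>f'' s\<bar> \<le> K"
  shows "\<bar>(f (x - k) + f (x + k)) / 2 - f x\<bar> \<le> K * k\<^sup>2"
proof -
  have first: "\<bar>f' (x + s) - f' (x - s)\<bar> \<le> 2 * K * s ^ 1" if s: "s \<in> {0..k}" for s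
  proof -
    have "\<bar>f' (x + s) - f' (x - s)\<bar> \<le> 2 * K * s ^ Suc 0"
    proof (rule abs_le_power_of_deriv[where \<phi> = "\<lambda>s. f' (x + s) - f' (x - s)"
          and \<phi>' = "\<lambda>s. f'' (x + s) + f'' (x - s)"])
      fix r assume r: "r \<in> {0..s}"
      show "((\<lambda>s. f' (x + s) - f' (x - s)) has_real_derivative f'' (x + r) + f'' (x - r)) (at r)"
        using r s by (auto intro!: derivative_eq_intros DERIV_chain2[OF assms(4)])
      show "\<bar>f'' (x + r) + f'' (x - r)\<bar> \<le> 2 * K * r ^ 0"
        using r s assms(5)[of "x + r"] assms(5)[of "x - r"] by auto
    qed (use s assms(2) in auto)
    then show ?thesis by simp
  qed
  have "\<bar>f (x + k) + f (x - k) - 2 * f x\<bar> \<le> 2 * K * k ^ Suc 1"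
  proof (rule abs_le_power_of_deriv[where \<phi> = "\<lambda>s. f (x + s) + f (x - s) - 2 * f x"
        and \<phi>' = "\<lambda>s. f' (x + s) - f' (x - s)"])
    fix s assume "s \<in> {0..k}"
    then show "((\<lambda>s. f (x + s) + f (x - s) - 2 * f x) has_real_derivative f' (x + s) - f' (x - s)) (at s)"
      by (auto intro!: derivative_eq_intros DERIV_chain2[OF assms(3)])
  qed (use assms(1,2) first in auto)
  then show ?thesis
    by (simp add: power2_eq_square) argo
qed

text \<open>Forward and backward differences on the grid are both central differences once the value of an
  interval is attached to its midpoint.\<close>

definition cdiff :: "real \<Rightarrow> (real \<Rightarrow> real) \<Rightarrow> real \<Rightarrow> real" where
  "cdiff h f x = (f (x + h / 2) - f (x - h / 2)) / h"

lemma cdiff_linear: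
  "cdiff h (\<lambda>x. f x + g x) x = cdiff h f x + cdiff h g x"
  "cdiff h (\<lambda>x. f x - g x) x = cdiff h f x - cdiff h g x"
  "cdiff h (\<lambda>x. c * f x) x = c * cdiff h f x"
  "cdiff h (\<lambda>x. f x / c) x = cdiff h f x / c"
  by (simp_all add: cdiff_def add_divide_distrib diff_divide_distrib right_diff_distrib mult.commute)

text \<open>The error is odd in \<open>h\<close> before division by \<open>h\<close>, hence cubic; its derivative in \<open>h\<close> is an
  averaging error of \<open>f'\<close>.\<close>

lemma cdiff_error:
  fixes f :: "real \<Rightarrow> real"
  assumes "h > 0" and "K \<ge> 0"
    and "\<And>s. (f has_real_derivative f1 s) (at s)"
    and "\<And>s. (f1 has_real_derivative f2 s) (at s)"
    and "\<And>s. (f2 has_real_derivative f3 s) (at s)"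
    and "\<And>s. \<bar>f3 s\<bar> \<le> K"
  shows "\<bar>cdiff h f x - f1 x\<bar> \<le> K * h\<^sup>2"
proof -
  define k where "k = h / 2"
  have k: "k > 0" "h = 2 * k" using assms(1) by (auto simp: k_def)
  have "\<bar>f (x + k) - f (x - k) - 2 * k * f1 x\<bar> \<le> 2 * K * k ^ Suc 2"
  proof (rule abs_le_power_of_deriv[where \<phi> = "\<lambda>s. f (x + s) - f (x - s) - 2 * s * f1 x"
        and \<phi>' = "\<lambda>s. f1 (x + s) + f1 (x - s) - 2 * f1 x"])
    fix s assume s: "s \<in> {0..k}"
    show "((\<lambda>s. f (x + s) - f (x - s) - 2 * s * f1 x) has_real_derivative
        f1 (x + s) + f1 (x - s) - 2 * f1 x) (at s)"
      by (auto intro!: derivative_eq_intros DERIV_chain2[OF assms(3)])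
    have "\<bar>(f1 (x - s) + f1 (x + s)) / 2 - f1 x\<bar> \<le> K * s\<^sup>2"
      using s assms by (intro average_error[of _ _ _ _ f2 f3]) auto
    then show "\<bar>f1 (x + s) + f1 (x - s) - 2 * f1 x\<bar> \<le> 2 * K * s\<^sup>2"
      by argo
  qed (use assms(2) k in auto)
  moreover have "f (x + k) - f (x - k) - 2 * k * f1 x = 2 * k * (cdiff h f x - f1 x)"
    using k by (simp add: cdiff_def field_simps)
  ultimately have "2 * k * \<bar>cdiff h f x - f1 x\<bar> \<le> 2 * k * (K * k\<^sup>2)"
    using k(1) by (simp add: abs_mult power2_eq_square power3_eq_cube ac_simps numeral_eq_Suc)
  then have "\<bar>cdiff h f x - f1 x\<bar> \<le> K * k\<^sup>2"
    using k(1) by simp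
  moreover have "K * k\<^sup>2 \<le> K * h\<^sup>2"
    using k assms(2) by (intro mult_left_mono power_mono) auto
  ultimately show ?thesis by linarith
qed


lemma has_real_derivative_cdiff:
  assumes "\<And>x. (f has_real_derivative f' x) (at x)"
  shows "(cdiff h f has_real_derivative cdiff h f' x) (at x)"
  unfolding cdiff_def
  by (rule DERIV_cdivide) (auto intro!: derivative_eq_intros DERIV_chain2[OF assms])

text \<open>A difference quotient costs one derivative but no negative power of \<open>h\<close>.\<close>

lemma bounded_derivs_cdiff:
  assumes "bounded_derivs (Suc k) I f" and h: "\<And>i. i \<in> I \<Longrightarrow> h i > 0"
  shows "bounded_derivs k I (\<lambda>i. cdiff (h i) (f i))"
  using assms(1)
proof (induction k arbitrary: f)
  case 0
  obtain f' where f': "\<And>i x. i \<in> I \<Longrightarrow> (f i has_real_derivative f' i x) (at x)"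
      "bounded_derivs 0 I f'"
    using 0 unfolding bounded_derivs.simps by metis
  obtain K where K: "\<And>i x. i \<in> I \<Longrightarrow> \<bar>f' i x\<bar> \<le> K"
    using bounded_derivs_bound[OF f'(2)] by metis
  have "\<bar>cdiff (h i) (f i) x\<bar> \<le> K" if i: "i \<in> I" for i x
  proof -
    have "\<bar>f i (x + h i / 2) - f i (x - h i / 2)\<bar> \<le> K * \<bar>(x + h i / 2) - (x - h i / 2)\<bar>"
      using field_differentiable_bound[of UNIV "f i" "f' i" K "x + h i / 2" "x - h i / 2"] f'(1)[OF i] K[OF i]
      by simp
    then show ?thesis
      using h[OF i] by (simp add: cdiff_def divide_le_eq)
  qed
  then show ?case by auto
next
  case (Suc k)
  obtain f' where f': "\<And>i x. i \<in> I \<Longrightarrow> (f i has_real_derivative f' i x) (at x)"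
      "bounded_derivs (Suc k) I f'"
    using Suc.prems unfolding bounded_derivs.simps(2)[of "Suc k"] by metis
  have d: "(cdiff (h i) (f i) has_real_derivative cdiff (h i) (f' i) x) (at x)" if i: "i \<in> I" for i x
    by (rule has_real_derivative_cdiff[OF f'(1)[OF i]])
  show ?case
    by (rule bounded_derivs_SucI[OF Suc.IH[OF bounded_derivs_pred[OF Suc.prems]] d Suc.IH[OF f'(2)]])
qed

text \<open>Differentiating the remainder gives the remainder of \<open>f'\<close>, so the scalar estimate \<open>cdiff_error\<close>
  controls all its derivatives.\<close>

lemma bounded_derivs_cdiff_error:
  assumes "bounded_derivs (k + 2) I f'" and h: "\<And>i. i \<in> I \<Longrightarrow> h i > 0"
    and "\<And>i x. i \<in> I \<Longrightarrow> (f i has_real_derivative f' i x) (at x)"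
  shows "bounded_derivs k I (\<lambda>i x. (cdiff (h i) (f i) x - f' i x) / (h i)\<^sup>2)"
  using assms(1,3)
proof (induction k arbitrary: f f')
  case 0
  obtain f2 where f2: "\<And>i x. i \<in> I \<Longrightarrow> (f' i has_real_derivative f2 i x) (at x)"
      "bounded_derivs (Suc 0) I f2"
    using 0(1) unfolding add_2_eq_Suc' bounded_derivs.simps(2)[of "Suc 0"] by metis
  obtain f3 where f3: "\<And>i x. i \<in> I \<Longrightarrow> (f2 i has_real_derivative f3 i x) (at x)"
      "bounded_derivs 0 I f3"
    using f2(2) unfolding bounded_derivs.simps by metis
  obtain K where K: "K \<ge> 0" "\<And>i x. i \<in> I \<Longrightarrow> \<bar>f3 i x\<bar> \<le> K"
    using bounded_derivs_bound[OF f3(2)] by metis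
  have "\<bar>(cdiff (h i) (f i) x - f' i x) / (h i)\<^sup>2\<bar> \<le> K" if i: "i \<in> I" for i x
  proof -
    have "\<bar>cdiff (h i) (f i) x - f' i x\<bar> \<le> K * (h i)\<^sup>2"
      by (rule cdiff_error[OF h[OF i] K(1) 0(2)[OF i] f2(1)[OF i] f3(1)[OF i] K(2)[OF i]])
    then show ?thesis
      using h[OF i] by (simp add: abs_mult divide_le_eq)
  qed
  then show ?case by auto
next
  case (Suc k)
  obtain f2 where f2: "\<And>i x. i \<in> I \<Longrightarrow> (f' i has_real_derivative f2 i x) (at x)"
      "bounded_derivs (k + 2) I f2"
    using Suc.prems(1) unfolding add_Suc bounded_derivs.simps(2)[of "k + 2"] by metis
  have d: "((\<lambda>x. (cdiff (h i) (f i) x - f' i x) / (h i)\<^sup>2) has_real_derivative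
      (cdiff (h i) (f' i) x - f2 i x) / (h i)\<^sup>2) (at x)" if i: "i \<in> I" for i x
    by (intro DERIV_cdivide DERIV_diff has_real_derivative_cdiff Suc.prems(2)[OF i] f2(1)[OF i])
  have "bounded_derivs (k + 2) I f'"
    by (rule bounded_derivs_mono[OF Suc.prems(1)]) simp
  then show ?case
    by (rule bounded_derivs_SucI[OF Suc.IH[OF _ Suc.prems(2)] d Suc.IH[OF f2(2) f2(1)]])
qed

section \<open>Mobilities that are accurate about the midpoint\<close>

definition C1_curve :: "real \<Rightarrow> real \<Rightarrow> (real \<Rightarrow> real) \<Rightarrow> (real \<Rightarrow> real) \<Rightarrow> bool" where
  "C1_curve a b f f' \<longleftrightarrow>
     (\<forall>y. f y \<in> {a..b} \<and> (f has_real_derivative f' y) (at y)) \<and> continuous_on UNIV f'"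

text \<open>In the coordinates \<open>\<sigma> = (s1 + s2)/2\<close> and \<open>\<rho> = (s2 - s1)/2\<close> the bounds say
  \<open>m = M(\<sigma>) + O(\<rho>\<^sup>2)\<close>, \<open>\<partial>m/\<partial>\<sigma> = M'(\<sigma>) + O(\<rho>\<^sup>2)\<close> and \<open>\<partial>m/\<partial>\<rho> = O(\<rho>)\<close>. They are stated along curves
  because only derivatives along curves are used, and for the mobility defined by an integral these
  require differentiation under the integral sign in a single real variable. On the curves
  \<open>u(y - h/2)\<close> and \<open>u(y + h/2)\<close> both \<open>g - f\<close> and \<open>g' - f'\<close> are \<open>O(h)\<close>, so the second bound is
  \<open>O(h\<^sup>2)\<close>.\<close>

definition midpoint_accurate ::
    "real \<Rightarrow> real \<Rightarrow> (real \<Rightarrow> real) \<Rightarrow> (real \<Rightarrow> real) \<Rightarrow> (real \<Rightarrow> real \<Rightarrow> real) \<Rightarrow> bool" where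
  "midpoint_accurate a b M M' m \<longleftrightarrow> (\<exists>C\<ge>0.
     (\<forall>s1\<in>{a..b}. \<forall>s2\<in>{a..b}. \<bar>m s1 s2 - M ((s1 + s2) / 2)\<bar> \<le> C * (s2 - s1)\<^sup>2) \<and>
     (\<forall>f f' g g' y. C1_curve a b f f' \<and> C1_curve a b g g' \<longrightarrow>
        (\<exists>D. ((\<lambda>y. m (f y) (g y)) has_real_derivative D) (at y) \<and>
          \<bar>D - M' ((f y + g y) / 2) * ((f' y + g' y) / 2)\<bar>
            \<le> C * ((g y - f y)\<^sup>2 * \<bar>f' y + g' y\<bar> + \<bar>g y - f y\<bar> * \<bar>g' y - f' y\<bar>))))"

lemma mean_minus_middle_bound:
  fixes f :: "real \<Rightarrow> real"
  assumes "h > 0" and "K \<ge> 0"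
    and "\<And>s. (f has_real_derivative f' s) (at s)"
    and "\<And>s. (f' has_real_derivative f'' s) (at s)"
    and "\<And>s. \<bar>f'' s\<bar> \<le> K"
  shows "\<bar>(f (x - h / 2) + f (x + h / 2)) / 2 - f x\<bar> \<le> K * h\<^sup>2"
proof -
  have "\<bar>(f (x - h / 2) + f (x + h / 2)) / 2 - f x\<bar> \<le> K * (h / 2)\<^sup>2"
    using assms by (intro average_error[of _ _ _ _ f' f'']) auto
  also have "\<dots> \<le> K * h\<^sup>2"
    using assms(1,2) by (intro mult_left_mono power_mono) auto
  finally show ?thesis .
qed

lemma increment_bound:
  fixes f :: "real \<Rightarrow> real"
  assumes "h > 0" and "\<And>s. (f has_real_derivative f' s) (at s)" and "\<And>s. \<bar>f' s\<bar> \<le> K"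
  shows "\<bar>f (x + h / 2) - f (x - h / 2)\<bar> \<le> K * h"
  using field_differentiable_bound[of UNIV f f' K "x + h / 2" "x - h / 2"] assms by simp

lemma C1_curve_shift:
  assumes "\<And>x. f x \<in> {a..b}" and "\<And>x. (f has_real_derivative f' x) (at x)"
    and "\<And>x. (f' has_real_derivative f'' x) (at x)"
  shows "C1_curve a b (\<lambda>x. f (x + c)) (\<lambda>x. f' (x + c))"
  unfolding C1_curve_def
proof (intro conjI allI assms(1))
  show "((\<lambda>x. f (x + c)) has_real_derivative f' (y + c)) (at y)" for y
    by (rule DERIV_shift[THEN iffD1, OF assms(2)])
  have "continuous_on UNIV f'"
    using assms(3) by (intro DERIV_continuous_on) auto
  then show "continuous_on UNIV (\<lambda>x. f' (x + c))"
    by (rule continuous_on_compose2) (auto intro: continuous_intros)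
qed

text \<open>The definition compares \<open>m\<close> with \<open>M\<close> at the mean \<open>\<sigma>\<close> of the two neighbouring values of \<open>u\<close>.
  Replacing \<open>\<sigma>\<close> by \<open>u\<close> itself, and \<open>\<sigma>\<^sub>y\<close> by \<open>u\<^sub>y\<close>, costs averaging errors of order \<open>h\<^sup>2\<close>.\<close>

lemma midpoint_accurate_expansion:
  assumes mid: "midpoint_accurate a b M M' m" and "a > 0"
    and M: "\<And>s. s > 0 \<Longrightarrow> (M has_real_derivative M' s) (at s)" and M': "C_k_on (Suc k) M' {0<..}"
    and u: "bounded_derivs 3 I u" and range: "\<And>i x. i \<in> I \<Longrightarrow> u i x \<in> {a..b}"
    and h: "\<And>i. i \<in> I \<Longrightarrow> h i > 0"
  shows "bounded_derivs 1 I
    (\<lambda>i x. (m (u i (x - h i / 2)) (u i (x + h i / 2)) - M (u i x)) / (h i)\<^sup>2)"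
proof -
  obtain C where "C \<ge> 0"
    and val: "\<And>s1 s2. s1 \<in> {a..b} \<Longrightarrow> s2 \<in> {a..b} \<Longrightarrow>
        \<bar>m s1 s2 - M ((s1 + s2) / 2)\<bar> \<le> C * (s2 - s1)\<^sup>2"
    and deriv: "\<And>f f' g g' y. C1_curve a b f f' \<Longrightarrow> C1_curve a b g g' \<Longrightarrow>
        \<exists>D. ((\<lambda>y. m (f y) (g y)) has_real_derivative D) (at y) \<and>
          \<bar>D - M' ((f y + g y) / 2) * ((f' y + g' y) / 2)\<bar>
            \<le> C * ((g y - f y)\<^sup>2 * \<bar>f' y + g' y\<bar> + \<bar>g y - f y\<bar> * \<bar>g' y - f' y\<bar>)"
    using mid unfolding midpoint_accurate_def by blast
  have sub: "{a..b} \<subseteq> {0<..}"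
    using \<open>a > 0\<close> by auto
  have sub': "s > 0" if "s \<in> {a..b}" for s
    using that sub by auto
  obtain M'' where M'': "\<And>s. s > 0 \<Longrightarrow> (M' has_real_derivative M'' s) (at s)"
      "C_k_on k M'' {0<..}"
    using C_k_on_real_deriv[OF M'] unfolding greaterThan_iff by blast
  obtain K1 where K1: "K1 \<ge> 0" "\<And>s. s \<in> {a..b} \<Longrightarrow> \<bar>M' s\<bar> \<le> K1"
    using continuous_bounded_on[OF C_k_on_imp_continuous_on[OF M'] compact_Icc sub] by metis
  obtain K2 where K2: "K2 \<ge> 0" "\<And>s. s \<in> {a..b} \<Longrightarrow> \<bar>M'' s\<bar> \<le> K2"
    using continuous_bounded_on[OF C_k_on_imp_continuous_on[OF M''(2)] compact_Icc sub] by metis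
  have lip1: "\<bar>M s - M r\<bar> \<le> K1 * \<bar>s - r\<bar>" if "s \<in> {a..b}" "r \<in> {a..b}" for s r
    using field_differentiable_bound[of "{a..b}" M M' K1 s r] M K1(2) sub' that
    by (auto simp: has_field_derivative_at_within)
  have lip2: "\<bar>M' s - M' r\<bar> \<le> K2 * \<bar>s - r\<bar>" if "s \<in> {a..b}" "r \<in> {a..b}" for s r
    using field_differentiable_bound[of "{a..b}" M' M'' K2 s r] M'' K2(2) sub' that
    by (auto simp: has_field_derivative_at_within)
  obtain u1 where u1: "\<And>i x. i \<in> I \<Longrightarrow> (u i has_real_derivative u1 i x) (at x)" "bounded_derivs 2 I u1"
    using u unfolding numeral_3_eq_3 numeral_2_eq_2 bounded_derivs.simps(2)[of "Suc (Suc 0)"] by metis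
  obtain u2 where u2: "\<And>i x. i \<in> I \<Longrightarrow> (u1 i has_real_derivative u2 i x) (at x)" "bounded_derivs 1 I u2"
    using u1(2) unfolding numeral_2_eq_2 One_nat_def bounded_derivs.simps(2)[of "Suc 0"] by metis
  obtain u3 where u3: "\<And>i x. i \<in> I \<Longrightarrow> (u2 i has_real_derivative u3 i x) (at x)" "bounded_derivs 0 I u3"
    using u2(2) unfolding One_nat_def bounded_derivs.simps by metis
  obtain B1 where B1: "B1 \<ge> 0" "\<And>i x. i \<in> I \<Longrightarrow> \<bar>u1 i x\<bar> \<le> B1"
    using bounded_derivs_bound[OF u1(2)] by metis
  obtain B2 where B2: "B2 \<ge> 0" "\<And>i x. i \<in> I \<Longrightarrow> \<bar>u2 i x\<bar> \<le> B2"
    using bounded_derivs_bound[OF u2(2)] by metis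
  obtain B3 where B3: "B3 \<ge> 0" "\<And>i x. i \<in> I \<Longrightarrow> \<bar>u3 i x\<bar> \<le> B3"
    using bounded_derivs_bound[OF u3(2)] by metis
  let ?l = "\<lambda>i x. u i (x - h i / 2)" and ?r = "\<lambda>i x. u i (x + h i / 2)"
  let ?l1 = "\<lambda>i x. u1 i (x - h i / 2)" and ?r1 = "\<lambda>i x. u1 i (x + h i / 2)"
  have mean_range: "(?l i x + ?r i x) / 2 \<in> {a..b}" if "i \<in> I" for i x
    using range[OF that, of "x - h i / 2"] range[OF that, of "x + h i / 2"] by auto
  have mean: "\<bar>(?l i x + ?r i x) / 2 - u i x\<bar> \<le> B2 * (h i)\<^sup>2" if "i \<in> I" for i x
    by (rule mean_minus_middle_bound[OF h[OF that] B2(1) u1(1)[OF that] u2(1)[OF that] B2(2)[OF that]])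
  have mean1: "\<bar>(?l1 i x + ?r1 i x) / 2 - u1 i x\<bar> \<le> B3 * (h i)\<^sup>2" if "i \<in> I" for i x
    by (rule mean_minus_middle_bound[OF h[OF that] B3(1) u2(1)[OF that] u3(1)[OF that] B3(2)[OF that]])
  have incr: "\<bar>?r i x - ?l i x\<bar> \<le> B1 * h i" if "i \<in> I" for i x
    by (rule increment_bound[OF h[OF that] u1(1)[OF that] B1(2)[OF that]])
  have incr1: "\<bar>?r1 i x - ?l1 i x\<bar> \<le> B2 * h i" if "i \<in> I" for i x
    by (rule increment_bound[OF h[OF that] u2(1)[OF that] B2(2)[OF that]])
  have incr_sq: "(?r i x - ?l i x)\<^sup>2 \<le> B1\<^sup>2 * (h i)\<^sup>2" if "i \<in> I" for i x
    using power_mono[OF incr[OF that, of x], of 2] by (simp add: power_mult_distrib)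
  have curve_l: "C1_curve a b (?l i) (?l1 i)" if i: "i \<in> I" for i
    using C1_curve_shift[OF range[OF i] u1(1)[OF i] u2(1)[OF i], of "- (h i / 2)"] by simp
  have curve_r: "C1_curve a b (?r i) (?r1 i)" if i: "i \<in> I" for i
    by (rule C1_curve_shift[OF range[OF i] u1(1)[OF i] u2(1)[OF i]])
  define K where "K = C * B1\<^sup>2 + K1 * B2"
  have bound: "\<bar>(m (?l i x) (?r i x) - M (u i x)) / (h i)\<^sup>2\<bar> \<le> K" if i: "i \<in> I" for i x
  proof -
    have "\<bar>m (?l i x) (?r i x) - M ((?l i x + ?r i x) / 2)\<bar> \<le> C * (B1\<^sup>2 * (h i)\<^sup>2)"
      using val[OF range[OF i] range[OF i]] mult_left_mono[OF incr_sq[OF i] \<open>C \<ge> 0\<close>] by (rule order_trans)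
    moreover have "\<bar>M ((?l i x + ?r i x) / 2) - M (u i x)\<bar> \<le> K1 * (B2 * (h i)\<^sup>2)"
      using lip1[OF mean_range[OF i] range[OF i]] mult_left_mono[OF mean[OF i] K1(1)] by (rule order_trans)
    ultimately have "\<bar>m (?l i x) (?r i x) - M (u i x)\<bar> \<le> K * (h i)\<^sup>2"
      unfolding K_def by (simp add: algebra_simps)
    then show ?thesis
      using h[OF i] by (simp add: divide_le_eq)
  qed
  define K' where "K' = C * (B1\<^sup>2 * (2 * B1) + B1 * B2) + (K2 * B2 * B1 + K1 * B3)"
  have derivative: "\<exists>D. ((\<lambda>x. (m (?l i x) (?r i x) - M (u i x)) / (h i)\<^sup>2) has_real_derivative D) (at x) \<and> \<bar>D\<bar> \<le> K'"
    if i: "i \<in> I" for i x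
  proof -
    let ?\<sigma> = "(?l i x + ?r i x) / 2" and ?\<sigma>1 = "(?l1 i x + ?r1 i x) / 2"
    obtain D where D: "((\<lambda>x. m (?l i x) (?r i x)) has_real_derivative D) (at x)"
      and D_bound: "\<bar>D - M' ?\<sigma> * ?\<sigma>1\<bar>
        \<le> C * ((?r i x - ?l i x)\<^sup>2 * \<bar>?l1 i x + ?r1 i x\<bar> + \<bar>?r i x - ?l i x\<bar> * \<bar>?r1 i x - ?l1 i x\<bar>)"
      using deriv[OF curve_l[OF i] curve_r[OF i], of x] by blast
    have sum1: "\<bar>?l1 i x + ?r1 i x\<bar> \<le> 2 * B1"
      using B1(2)[OF i, of "x - h i / 2"] B1(2)[OF i, of "x + h i / 2"] by linarith
    have "(?r i x - ?l i x)\<^sup>2 * \<bar>?l1 i x + ?r1 i x\<bar> \<le> (B1\<^sup>2 * (h i)\<^sup>2) * (2 * B1)"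
      by (rule mult_mono[OF incr_sq[OF i] sum1]) auto
    moreover have "\<bar>?r i x - ?l i x\<bar> * \<bar>?r1 i x - ?l1 i x\<bar> \<le> (B1 * h i) * (B2 * h i)"
      by (rule mult_mono[OF incr[OF i] incr1[OF i]]) (use B1(1) h[OF i] in auto)
    ultimately have "\<bar>D - M' ?\<sigma> * ?\<sigma>1\<bar> \<le> C * ((B1\<^sup>2 * (h i)\<^sup>2) * (2 * B1) + (B1 * h i) * (B2 * h i))"
      using D_bound mult_left_mono[OF add_mono \<open>C \<ge> 0\<close>] by (meson order_trans)
    moreover have "\<bar>(M' ?\<sigma> - M' (u i x)) * ?\<sigma>1\<bar> \<le> (K2 * (B2 * (h i)\<^sup>2)) * B1"
    proof -
      have "\<bar>M' ?\<sigma> - M' (u i x)\<bar> \<le> K2 * (B2 * (h i)\<^sup>2)"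
        using lip2[OF mean_range[OF i] range[OF i]] mult_left_mono[OF mean[OF i] K2(1)] by (rule order_trans)
      moreover have "\<bar>?\<sigma>1\<bar> \<le> B1"
        using sum1 by simp
      ultimately show ?thesis
        unfolding abs_mult using K2(1) B2(1) by (intro mult_mono) auto
    qed
    moreover have "\<bar>M' (u i x) * (?\<sigma>1 - u1 i x)\<bar> \<le> K1 * (B3 * (h i)\<^sup>2)"
      unfolding abs_mult by (rule mult_mono[OF K1(2)[OF range[OF i]] mean1[OF i] K1(1) abs_ge_zero])
    moreover have "D - M' (u i x) * u1 i x = (D - M' ?\<sigma> * ?\<sigma>1) + (M' ?\<sigma> - M' (u i x)) * ?\<sigma>1
        + M' (u i x) * (?\<sigma>1 - u1 i x)"
      by (simp add: algebra_simps)
    ultimately have "\<bar>D - M' (u i x) * u1 i x\<bar> \<le> C * ((B1\<^sup>2 * (h i)\<^sup>2) * (2 * B1) + (B1 * h i) * (B2 * h i))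
        + (K2 * (B2 * (h i)\<^sup>2)) * B1 + K1 * (B3 * (h i)\<^sup>2)"
      by linarith
    also have "\<dots> = K' * (h i)\<^sup>2"
      unfolding K'_def by (simp add: algebra_simps power2_eq_square)
    finally have "\<bar>(D - M' (u i x) * u1 i x) / (h i)\<^sup>2\<bar> \<le> K'"
      using h[OF i] by (simp add: divide_le_eq)
    moreover have "((\<lambda>x. (m (?l i x) (?r i x) - M (u i x)) / (h i)\<^sup>2) has_real_derivative
        (D - M' (u i x) * u1 i x) / (h i)\<^sup>2) (at x)"
      by (rule DERIV_cdivide[OF DERIV_diff[OF D DERIV_chain2[OF M[OF sub'[OF range[OF i]]] u1(1)[OF i]]]])
    ultimately show ?thesis by blast
  qed
  define E where "E i x = (m (?l i x) (?r i x) - M (u i x)) / (h i)\<^sup>2" for i x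
  have E: "(E i has_real_derivative deriv (E i) x) (at x) \<and> \<bar>deriv (E i) x\<bar> \<le> K'" if i: "i \<in> I" for i x
  proof -
    obtain D where D: "(E i has_real_derivative D) (at x)" "\<bar>D\<bar> \<le> K'"
      using derivative[OF i, of x] unfolding E_def[abs_def] by blast
    then show ?thesis
      using DERIV_imp_deriv[OF D(1)] by simp
  qed
  have E_bound: "bounded_derivs 0 I E"
    using bound unfolding E_def by auto
  have E'_bound: "bounded_derivs 0 I (\<lambda>i. deriv (E i))"
    using E by auto
  have "bounded_derivs 1 I E"
    unfolding One_nat_def by (rule bounded_derivs_SucI[OF E_bound E[THEN conjunct1] E'_bound])
  then show ?thesis
    by (simp only: E_def[abs_def])
qed


section \<open>The Generic Method\<close>

lemma has_real_derivative_along_curve: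
  fixes \<phi> :: "real \<times> real \<Rightarrow> real"
  assumes "\<phi> differentiable (at (f y, g y))"
    and "(f has_real_derivative f') (at y)" and "(g has_real_derivative g') (at y)"
  shows "((\<lambda>y. \<phi> (f y, g y)) has_real_derivative
    frechet_derivative \<phi> (at (f y, g y)) (f', g')) (at y)"
proof -
  let ?D = "frechet_derivative \<phi> (at (f y, g y))"
  have D: "(\<phi> has_derivative ?D) (at (f y, g y))"
    using assms(1) by (simp add: frechet_derivative_works)
  have "((\<lambda>y. (f y, g y)) has_derivative (\<lambda>h. (f' * h, g' * h))) (at y)"
    using assms(2,3) by (intro has_derivative_Pair) (simp_all add: has_field_derivative_def)
  then have "((\<lambda>y. \<phi> (f y, g y)) has_derivative (\<lambda>h. ?D (f' * h, g' * h))) (at y)"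
    by (rule has_derivative_compose) (rule D)
  moreover have "?D (f' * h, g' * h) = ?D (f', g') * h" for h
    using linear_scale[OF has_derivative_linear[OF D], of h "(f', g')"] by (simp add: mult.commute)
  ultimately show ?thesis
    by (simp add: has_field_derivative_def)
qed

text \<open>Let \<open>S\<close> and \<open>R\<close> be the derivatives of \<open>m\<close> in the directions \<open>(1, 1)\<close> and \<open>(-1, 1)\<close>, that is, in
  \<open>\<sigma>\<close> and in \<open>\<rho>\<close>. By symmetry \<open>m\<close> and \<open>S\<close> are even in \<open>\<rho>\<close>, so they differ from their values on the
  diagonal, \<open>M\<close> and \<open>M'\<close>, by \<open>O(\<rho>\<^sup>2)\<close>; and \<open>R\<close> vanishes on the diagonal, so it is \<open>O(\<rho>)\<close>.\<close>

lemma GM_midpoint_accurate: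
  assumes GM: "GM_mobility M m" and "a > 0"
    and M: "\<And>s. s > 0 \<Longrightarrow> (M has_real_derivative M' s) (at s)"
  shows "midpoint_accurate a b M M' m"
proof -
  define Q :: "(real \<times> real) set" where "Q = {0<..} \<times> {0<..}"
  define \<mu> where "\<mu> = (\<lambda>(s1, s2). m s1 s2)"
  define D where "D = (\<lambda>f v. \<lambda>s::real \<times> real. frechet_derivative f (at s) v :: real)"
  have diag: "\<mu> (s, s) = M s" if "s > 0" for s
    using GM that by (simp add: GM_mobility_def \<mu>_def)
  have sym: "\<mu> (s1, s2) = \<mu> (s2, s1)" if "(s1, s2) \<in> Q" for s1 s2
    using GM that by (simp add: GM_mobility_def \<mu>_def Q_def)
  have C4: "C_k_on (Suc (Suc (Suc (Suc 0)))) \<mu> Q"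
    using GM by (simp add: GM_mobility_def \<mu>_def Q_def numeral_eq_Suc)
  have C3: "C_k_on (Suc (Suc (Suc 0))) (D \<mu> v) Q" for v
    using C4 unfolding C_k_on.simps(2)[of "Suc (Suc (Suc 0))"] D_def by blast
  have C2: "C_k_on (Suc (Suc 0)) (D (D \<mu> v) w) Q" for v w
    using C3[of v] unfolding C_k_on.simps(2)[of "Suc (Suc 0)"] D_def by blast
  have C1: "C_k_on (Suc 0) (D (D (D \<mu> v) w) z) Q" for v w z
    using C2[of v w] unfolding C_k_on.simps(2)[of "Suc 0"] D_def by blast
  have deriv: "((\<lambda>y. \<phi> (f y, g y)) has_real_derivative D \<phi> (f', g') (f y, g y)) (at y)"
    if "C_k_on (Suc k) \<phi> Q" "(f y, g y) \<in> Q"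
      "(f has_real_derivative f') (at y)" "(g has_real_derivative g') (at y)"
    for k \<phi> f g f' g' y
    unfolding D_def using that by (intro has_real_derivative_along_curve) auto
  have box: "{a..b} \<times> {a..b} \<subseteq> Q"
    using \<open>a > 0\<close> by (auto simp: Q_def)
  have bounded: "\<exists>K\<ge>0. \<forall>s\<in>{a..b} \<times> {a..b}. \<bar>\<phi> s\<bar> \<le> K" if "C_k_on k \<phi> Q" for k \<phi>
    using continuous_bounded_on[OF C_k_on_imp_continuous_on[OF that] compact_Times[OF compact_Icc compact_Icc] box]
    by metis
  have linear: "linear (\<lambda>v. D \<mu> v s)" if "s \<in> Q" for s
  proof -
    have "\<mu> differentiable (at s)"
      using C4 that unfolding C_k_on.simps(2)[of "Suc (Suc (Suc 0))"] by blast
    then have "linear (frechet_derivative \<mu> (at s))"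
      by (rule linear_frechet_derivative)
    then show ?thesis by (simp add: D_def)
  qed
  have D_sym: "D \<mu> (v1, v2) (s1, s2) = D \<mu> (v2, v1) (s2, s1)" if s: "(s1, s2) \<in> Q" for s1 s2 v1 v2
  proof -
    have line: "((\<lambda>y. s + y * v) has_real_derivative v) (at 0)" for s v :: real
      by (auto intro!: derivative_eq_intros)
    have d1: "((\<lambda>y. \<mu> (s1 + y * v1, s2 + y * v2)) has_real_derivative D \<mu> (v1, v2) (s1, s2)) (at 0)"
      using deriv[OF C4 _ line[of s1 v1] line[of s2 v2]] s by simp
    have d2: "((\<lambda>y. \<mu> (s2 + y * v2, s1 + y * v1)) has_real_derivative D \<mu> (v2, v1) (s2, s1)) (at 0)"
      using deriv[OF C4 _ line[of s2 v2] line[of s1 v1]] s by (simp add: Q_def)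
    have "((\<lambda>y. s1 + y * v1) \<longlongrightarrow> s1 + 0 * v1) (at 0)" "((\<lambda>y. s2 + y * v2) \<longlongrightarrow> s2 + 0 * v2) (at 0)"
      by (intro tendsto_intros)+
    then have "eventually (\<lambda>y. s1 + y * v1 > 0) (at 0)" "eventually (\<lambda>y. s2 + y * v2 > 0) (at 0)"
      using s by (auto simp: Q_def intro: order_tendstoD)
    then have "eventually (\<lambda>y. \<mu> (s1 + y * v1, s2 + y * v2) = \<mu> (s2 + y * v2, s1 + y * v1)) (at 0)"
      by eventually_elim (auto intro!: sym simp: Q_def)
    then have "((\<lambda>y. \<mu> (s1 + y * v1, s2 + y * v2)) has_real_derivative D \<mu> (v2, v1) (s2, s1)) (at 0)"
      using d2 sym[OF s] by (subst has_field_derivative_cong_eventually) auto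
    then show ?thesis
      using d1 by (rule DERIV_unique[rotated])
  qed
  define S where "S = D \<mu> (1, 1)"
  define R where "R = D \<mu> (-1, 1)"
  have S_diag: "S (s, s) = M' s" if "s > 0" for s
  proof -
    have d1: "((\<lambda>y. \<mu> (y, y)) has_real_derivative S (s, s)) (at s)"
      unfolding S_def using that by (intro deriv[OF C4]) (auto simp: Q_def)
    have "((\<lambda>y. \<mu> (y, y)) has_real_derivative M' s) (at s)"
      by (rule has_field_derivative_transform_within_open[OF M[OF that], of "{0<..}"])
        (use that diag in auto)
    with d1 show ?thesis by (rule DERIV_unique)
  qed
  have R_diag: "R (s, s) = 0" if "s > 0" for s
  proof -
    have s: "(s, s) \<in> Q" using that by (simp add: Q_def)
    have "R (s, s) = D \<mu> (1, -1) (s, s)"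
      unfolding R_def by (rule D_sym[OF s])
    also have "\<dots> = - R (s, s)"
      unfolding R_def using linear_neg[OF linear[OF s], of "(-1, 1)"] by simp
    finally show ?thesis by simp
  qed
  obtain K1 where K1: "K1 \<ge> 0" "\<And>s. s \<in> {a..b} \<times> {a..b} \<Longrightarrow> \<bar>D R (-1, 1) s\<bar> \<le> K1"
    using bounded[OF C2] unfolding R_def by metis
  obtain K2 where K2: "K2 \<ge> 0" "\<And>s. s \<in> {a..b} \<times> {a..b} \<Longrightarrow> \<bar>D (D S (-1, 1)) (-1, 1) s\<bar> \<le> K2"
    using bounded[OF C1] unfolding S_def by metis
  \<comment> \<open>for an even function of \<open>\<rho>\<close> the average over \<open>\<plusminus>\<rho>\<close> is the value at \<open>\<rho>\<close> itself\<close>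
  have even_bound: "\<bar>\<phi> (s1, s2) - \<phi> ((s1 + s2) / 2, (s1 + s2) / 2)\<bar> \<le> K * ((s2 - s1) / 2)\<^sup>2"
    if \<phi>: "C_k_on (Suc k) \<phi> Q" "C_k_on (Suc l) (D \<phi> (-1, 1)) Q"
      and even: "\<And>s1 s2. (s1, s2) \<in> Q \<Longrightarrow> \<phi> (s1, s2) = \<phi> (s2, s1)"
      and K: "K \<ge> 0" "\<And>s. s \<in> {a..b} \<times> {a..b} \<Longrightarrow> \<bar>D (D \<phi> (-1, 1)) (-1, 1) s\<bar> \<le> K"
      and s: "s1 \<in> {a..b}" "s2 \<in> {a..b}"
    for k l \<phi> K s1 s2
  proof -
    define \<sigma> \<rho> where "\<sigma> = (s1 + s2) / 2" and "\<rho> = (s2 - s1) / 2"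
    have inside: "(\<sigma> - r, \<sigma> + r) \<in> {a..b} \<times> {a..b}" if "\<bar>r\<bar> \<le> \<bar>\<rho>\<bar>" for r
      using that s unfolding \<sigma>_def \<rho>_def by (auto simp: abs_if field_simps split: if_splits)
    have "\<bar>(\<phi> (\<sigma> - (0 - \<bar>\<rho>\<bar>), \<sigma> + (0 - \<bar>\<rho>\<bar>)) + \<phi> (\<sigma> - (0 + \<bar>\<rho>\<bar>), \<sigma> + (0 + \<bar>\<rho>\<bar>))) / 2 - \<phi> (\<sigma> - 0, \<sigma> + 0)\<bar>
        \<le> K * \<bar>\<rho>\<bar>\<^sup>2"
    proof (rule average_error[where f = "\<lambda>r. \<phi> (\<sigma> - r, \<sigma> + r)"])
      fix r assume "r \<in> {0 - \<bar>\<rho>\<bar>..0 + \<bar>\<rho>\<bar>}"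
      then have "\<bar>r\<bar> \<le> \<bar>\<rho>\<bar>" by auto
      note r = inside[OF this]
      show "((\<lambda>r. \<phi> (\<sigma> - r, \<sigma> + r)) has_real_derivative D \<phi> (-1, 1) (\<sigma> - r, \<sigma> + r)) (at r)"
        using r box by (intro deriv[OF \<phi>(1)]) (auto intro!: derivative_eq_intros)
      show "((\<lambda>r. D \<phi> (-1, 1) (\<sigma> - r, \<sigma> + r)) has_real_derivative D (D \<phi> (-1, 1)) (-1, 1) (\<sigma> - r, \<sigma> + r)) (at r)"
        using r box by (intro deriv[OF \<phi>(2)]) (auto intro!: derivative_eq_intros)
      show "\<bar>D (D \<phi> (-1, 1)) (-1, 1) (\<sigma> - r, \<sigma> + r)\<bar> \<le> K"
        by (rule K(2)[OF r])
    qed (use K(1) in auto)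
    moreover have "\<phi> (\<sigma> - \<bar>\<rho>\<bar>, \<sigma> + \<bar>\<rho>\<bar>) = \<phi> (s1, s2)" "\<phi> (\<sigma> + \<bar>\<rho>\<bar>, \<sigma> - \<bar>\<rho>\<bar>) = \<phi> (s1, s2)"
    proof -
      have "\<sigma> - \<rho> = s1" "\<sigma> + \<rho> = s2"
        unfolding \<sigma>_def \<rho>_def by (simp_all add: field_simps)
      moreover have "\<phi> (s2, s1) = \<phi> (s1, s2)"
        using s box by (intro even) blast
      ultimately show "\<phi> (\<sigma> - \<bar>\<rho>\<bar>, \<sigma> + \<bar>\<rho>\<bar>) = \<phi> (s1, s2)" "\<phi> (\<sigma> + \<bar>\<rho>\<bar>, \<sigma> - \<bar>\<rho>\<bar>) = \<phi> (s1, s2)"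
        by (auto simp: abs_if)
    qed
    ultimately show ?thesis
      unfolding \<sigma>_def[symmetric] \<rho>_def[symmetric] by simp
  qed
  have R_bound: "\<bar>R (s1, s2)\<bar> \<le> K1 * \<bar>(s2 - s1) / 2\<bar>" if s: "s1 \<in> {a..b}" "s2 \<in> {a..b}" for s1 s2
  proof -
    define \<sigma> \<rho> where "\<sigma> = (s1 + s2) / 2" and "\<rho> = (s2 - s1) / 2"
    have inside: "(\<sigma> - r, \<sigma> + r) \<in> {a..b} \<times> {a..b}" if "\<bar>r\<bar> \<le> \<bar>\<rho>\<bar>" for r
      using that s unfolding \<sigma>_def \<rho>_def by (auto simp: abs_if field_simps split: if_splits)
    have "norm (R (\<sigma> - \<rho>, \<sigma> + \<rho>) - R (\<sigma> - 0, \<sigma> + 0)) \<le> K1 * norm (\<rho> - 0)"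
    proof (rule field_differentiable_bound[where S = "{-\<bar>\<rho>\<bar>..\<bar>\<rho>\<bar>}" and f = "\<lambda>r. R (\<sigma> - r, \<sigma> + r)"
          and f' = "\<lambda>r. D R (-1, 1) (\<sigma> - r, \<sigma> + r)"])
      fix r assume "r \<in> {-\<bar>\<rho>\<bar>..\<bar>\<rho>\<bar>}"
      then have "\<bar>r\<bar> \<le> \<bar>\<rho>\<bar>" by auto
      note r = inside[OF this]
      have "((\<lambda>r. R (\<sigma> - r, \<sigma> + r)) has_real_derivative D R (-1, 1) (\<sigma> - r, \<sigma> + r)) (at r)"
        unfolding R_def using r box by (intro deriv[OF C3]) (auto intro!: derivative_eq_intros)
      then show "((\<lambda>r. R (\<sigma> - r, \<sigma> + r)) has_real_derivative D R (-1, 1) (\<sigma> - r, \<sigma> + r))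
          (at r within {-\<bar>\<rho>\<bar>..\<bar>\<rho>\<bar>})"
        by (rule has_field_derivative_at_within)
      show "norm (D R (-1, 1) (\<sigma> - r, \<sigma> + r)) \<le> K1"
        using K1(2)[OF r] by simp
    qed auto
    moreover have "\<sigma> - \<rho> = s1" "\<sigma> + \<rho> = s2"
      unfolding \<sigma>_def \<rho>_def by (simp_all add: field_simps)
    moreover have "\<sigma> > 0"
      using s \<open>a > 0\<close> by (auto simp: \<sigma>_def)
    ultimately show ?thesis
      by (simp add: R_diag \<rho>_def)
  qed
  have S_sym: "S (s1, s2) = S (s2, s1)" if "(s1, s2) \<in> Q" for s1 s2
    unfolding S_def by (rule D_sym[OF that])
  show ?thesis
    unfolding midpoint_accurate_def
  proof (rule exI[of _ "K1 + K2"], intro conjI ballI allI impI)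
    show "0 \<le> K1 + K2"
      using K1 K2 by simp
    fix s1 s2 assume s: "s1 \<in> {a..b}" "s2 \<in> {a..b}"
    have "\<bar>\<mu> (s1, s2) - \<mu> ((s1 + s2) / 2, (s1 + s2) / 2)\<bar> \<le> K1 * ((s2 - s1) / 2)\<^sup>2"
      using K1 unfolding R_def by (intro even_bound[OF C4 C3] sym s)
    also have "\<dots> \<le> (K1 + K2) * (s2 - s1)\<^sup>2"
      using K1 K2 by (intro mult_mono) (auto simp: power_divide)
    finally show "\<bar>m s1 s2 - M ((s1 + s2) / 2)\<bar> \<le> (K1 + K2) * (s2 - s1)\<^sup>2"
      using s \<open>a > 0\<close> by (simp add: diag) (simp add: \<mu>_def)
  next
    fix f f' g g' y
    assume curves: "C1_curve a b f f' \<and> C1_curve a b g g'"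
    then have fg: "f y \<in> {a..b}" "g y \<in> {a..b}"
      and d: "(f has_real_derivative f' y) (at y)" "(g has_real_derivative g' y) (at y)"
      by (auto simp: C1_curve_def)
    have in_Q: "(f y, g y) \<in> Q"
      using fg box by blast
    let ?\<sigma> = "(f y + g y) / 2" and ?E = "D \<mu> (f' y, g' y) (f y, g y)"
    have "((\<lambda>y. m (f y) (g y)) has_real_derivative ?E) (at y)"
      using deriv[OF C4 in_Q d] by (simp add: \<mu>_def)
    moreover have "\<bar>?E - M' ?\<sigma> * ((f' y + g' y) / 2)\<bar>
        \<le> (K1 + K2) * ((g y - f y)\<^sup>2 * \<bar>f' y + g' y\<bar> + \<bar>g y - f y\<bar> * \<bar>g' y - f' y\<bar>)"
    proof -
      have "(f' y, g' y) = ((f' y + g' y) / 2) *\<^sub>R (1, 1) + ((g' y - f' y) / 2) *\<^sub>R (-1, 1)"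
        by (simp add: field_simps)
      then have E: "?E = (f' y + g' y) / 2 * S (f y, g y) + (g' y - f' y) / 2 * R (f y, g y)"
        using linear_add[OF linear[OF in_Q]] linear_scale[OF linear[OF in_Q]]
        unfolding S_def R_def by (metis real_scaleR_def)
      have "?\<sigma> > 0" using fg \<open>a > 0\<close> by auto
      have S: "\<bar>S (f y, g y) - M' ?\<sigma>\<bar> \<le> K2 * ((g y - f y) / 2)\<^sup>2"
        using even_bound[OF C3 C2 S_sym[unfolded S_def] K2[unfolded S_def] fg] S_diag[OF \<open>?\<sigma> > 0\<close>]
        unfolding S_def by simp
      have "\<bar>(f' y + g' y) / 2 * (S (f y, g y) - M' ?\<sigma>)\<bar> \<le> \<bar>f' y + g' y\<bar> * (K2 * (g y - f y)\<^sup>2)"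
      proof -
        have "\<bar>S (f y, g y) - M' ?\<sigma>\<bar> \<le> K2 * (g y - f y)\<^sup>2"
          by (rule order_trans[OF S mult_left_mono[OF _ K2(1)]]) (simp add: power_divide)
        moreover have "\<bar>(f' y + g' y) / 2\<bar> \<le> \<bar>f' y + g' y\<bar>"
          by simp
        ultimately show ?thesis
          unfolding abs_mult by (intro mult_mono) auto
      qed
      moreover have "\<bar>(g' y - f' y) / 2 * R (f y, g y)\<bar> \<le> \<bar>g' y - f' y\<bar> * (K1 * \<bar>g y - f y\<bar>)"
      proof -
        have "\<bar>R (f y, g y)\<bar> \<le> K1 * \<bar>g y - f y\<bar>"
          by (rule order_trans[OF R_bound[OF fg] mult_left_mono[OF _ K1(1)]]) simp
        moreover have "\<bar>(g' y - f' y) / 2\<bar> \<le> \<bar>g' y - f' y\<bar>"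
          by simp
        ultimately show ?thesis
          unfolding abs_mult by (intro mult_mono) auto
      qed
      moreover have "0 \<le> \<bar>f' y + g' y\<bar> * (K1 * (g y - f y)\<^sup>2)" "0 \<le> \<bar>g' y - f' y\<bar> * (K2 * \<bar>g y - f y\<bar>)"
        using K1(1) K2(1) by auto
      moreover have "?E - M' ?\<sigma> * ((f' y + g' y) / 2)
          = (f' y + g' y) / 2 * (S (f y, g y) - M' ?\<sigma>) + (g' y - f' y) / 2 * R (f y, g y)"
        unfolding E by (simp add: algebra_simps)
      moreover have "(K1 + K2) * ((g y - f y)\<^sup>2 * \<bar>f' y + g' y\<bar> + \<bar>g y - f y\<bar> * \<bar>g' y - f' y\<bar>)
          = \<bar>f' y + g' y\<bar> * (K2 * (g y - f y)\<^sup>2) + \<bar>g' y - f' y\<bar> * (K1 * \<bar>g y - f y\<bar>)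
            + \<bar>f' y + g' y\<bar> * (K1 * (g y - f y)\<^sup>2) + \<bar>g' y - f' y\<bar> * (K2 * \<bar>g y - f y\<bar>)"
        by (simp add: algebra_simps)
      ultimately show ?thesis by linarith
    qed
    ultimately show "\<exists>D. ((\<lambda>y. m (f y) (g y)) has_real_derivative D) (at y) \<and>
          \<bar>D - M' ((f y + g y) / 2) * ((f' y + g' y) / 2)\<bar>
            \<le> (K1 + K2) * ((g y - f y)\<^sup>2 * \<bar>f' y + g' y\<bar> + \<bar>g y - f y\<bar> * \<bar>g' y - f' y\<bar>)"
      by blast
  qed
qed


section \<open>The Bounded Entropy Method\<close>

lemma affine_in_Icc:
  fixes a b :: real
  assumes "r \<in> {0..1}" and "s1 \<in> {a..b}" and "s2 \<in> {a..b}"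
  shows "s1 + r * (s2 - s1) \<in> {a..b}"
proof -
  have "(1 - r) * s1 + r * s2 \<in> {a..b}"
    using assms(1) convexD_alt[OF convex_real_interval(5) assms(2,3), of r] by auto
  then show ?thesis by (simp add: algebra_simps)
qed

definition mean_resistance :: "(real \<Rightarrow> real) \<Rightarrow> real \<Rightarrow> real \<Rightarrow> real" where
  "mean_resistance \<gamma> s1 s2 = integral {0..1} (\<lambda>r. \<gamma> (s1 + r * (s2 - s1)))"

text \<open>After rescaling the integral to \<open>{0..1}\<close> the factor \<open>s2 - s1\<close> cancels, and the two cases in the
  definition of the mobility become one formula that can be differentiated across the diagonal.\<close>

lemma BEM_mobility_eq:
  assumes "s1 > 0" and "s2 > 0" and cont: "continuous_on {0<..} (\<lambda>s. 1 / M s)"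
  shows "BEM_mobility M s1 s2 = 1 / mean_resistance (\<lambda>s. 1 / M s) s1 s2"
proof (cases "s1 = s2")
  case True
  then show ?thesis by (simp add: BEM_mobility_def mean_resistance_def)
next
  case False
  let ?\<gamma> = "\<lambda>s. 1 / M s"
  define A where "A = min s1 s2"
  define B where "B = max s1 s2"
  define F where "F x = integral {A..x} ?\<gamma>" for x
  have "A > 0" "s1 \<in> {A..B}" "s2 \<in> {A..B}"
    using assms by (auto simp: A_def B_def)
  have cont_AB: "continuous_on {A..B} ?\<gamma>"
    using cont by (rule continuous_on_subset) (use \<open>A > 0\<close> in auto)
  have F: "(F has_vector_derivative ?\<gamma> x) (at x within {A..B})" if "x \<in> {A..B}" for x
    unfolding F_def by (rule integral_has_vector_derivative[OF cont_AB that])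
  have BEM: "(LBINT s=s1..s2. ?\<gamma> s) = F s2 - F s1"
    using cont_AB F unfolding A_def B_def by (intro interval_integral_FTC_finite) auto
  note segment = affine_in_Icc[OF _ \<open>s1 \<in> {A..B}\<close> \<open>s2 \<in> {A..B}\<close>]
  have "((\<lambda>r. (s2 - s1) * ?\<gamma> (s1 + r * (s2 - s1))) has_integral
      F (s1 + 1 * (s2 - s1)) - F (s1 + 0 * (s2 - s1))) {0..1}"
  proof (rule fundamental_theorem_of_calculus)
    fix r :: real assume r: "r \<in> {0..1}"
    have line: "((\<lambda>r. s1 + r * (s2 - s1)) has_vector_derivative s2 - s1) (at r within {0..1})"
      by (auto intro!: derivative_eq_intros simp flip: has_real_derivative_iff_has_vector_derivative)
    have "(F has_vector_derivative ?\<gamma> (s1 + r * (s2 - s1)))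
        (at (s1 + r * (s2 - s1)) within (\<lambda>r. s1 + r * (s2 - s1)) ` {0..1})"
      by (rule has_vector_derivative_within_subset[OF F[OF segment[OF r]]]) (use segment in blast)
    from vector_diff_chain_within[OF line this]
    show "((\<lambda>r. F (s1 + r * (s2 - s1))) has_vector_derivative
        (s2 - s1) * ?\<gamma> (s1 + r * (s2 - s1))) (at r within {0..1})"
      by (simp add: o_def)
  qed simp
  then have "integral {0..1} (\<lambda>r. (s2 - s1) * ?\<gamma> (s1 + r * (s2 - s1))) = F s2 - F s1"
    by (simp add: integral_unique)
  then have "(s2 - s1) * mean_resistance ?\<gamma> s1 s2 = F s2 - F s1"
    unfolding mean_resistance_def integral_mult_right .
  then have "BEM_mobility M s1 s2 = (s2 - s1) / ((s2 - s1) * mean_resistance ?\<gamma> s1 s2)"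
    using False BEM by (simp add: BEM_mobility_def)
  then show ?thesis
    using False by simp
qed

lemma linearization_error:
  fixes f :: "real \<Rightarrow> real"
  assumes "\<And>s. s \<in> {a..b} \<Longrightarrow> (f has_real_derivative f' s) (at s)"
    and "\<And>s. s \<in> {a..b} \<Longrightarrow> (f' has_real_derivative f'' s) (at s)"
    and "\<And>s. s \<in> {a..b} \<Longrightarrow> \<bar>f'' s\<bar> \<le> K"
    and x: "x \<in> {a..b}" and y: "y \<in> {a..b}"
  shows "\<bar>f y - f x - f' x * (y - x)\<bar> \<le> K * (y - x)\<^sup>2"
proof -
  define S where "S = {a..b} \<inter> {x - \<bar>y - x\<bar>..x + \<bar>y - x\<bar>}"
  have "K \<ge> 0"
    using assms(3)[OF x] by linarith
  have "norm ((f y - f' x * y) - (f x - f' x * x)) \<le> K * \<bar>y - x\<bar> * norm (y - x)"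
  proof (rule field_differentiable_bound[where S = S and f' = "\<lambda>s. f' s - f' x"])
    show "convex S"
      unfolding S_def by (intro convex_Int convex_real_interval)
    show "x \<in> S" "y \<in> S"
      using x y by (auto simp: S_def)
    fix s assume "s \<in> S"
    then have s: "s \<in> {a..b}" "\<bar>s - x\<bar> \<le> \<bar>y - x\<bar>"
      by (auto simp: S_def)
    show "((\<lambda>s. f s - f' x * s) has_real_derivative f' s - f' x) (at s within S)"
      by (rule has_field_derivative_at_within) (auto intro!: derivative_eq_intros assms(1)[OF s(1)])
    have "norm (f' s - f' x) \<le> K * norm (s - x)"
      by (rule field_differentiable_bound[of "{a..b}" f' f''])
        (use assms(2,3) s x in \<open>auto intro: has_field_derivative_at_within\<close>)
    also have "\<dots> \<le> K * \<bar>y - x\<bar>"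
      using s(2) \<open>K \<ge> 0\<close> by (simp add: mult_left_mono)
    finally show "norm (f' s - f' x) \<le> K * \<bar>y - x\<bar>" .
  qed
  then show ?thesis
    by (simp add: algebra_simps power2_eq_square flip: abs_mult)
qed

text \<open>The linear term has mean zero over \<open>{0..1}\<close>. With \<open>r = 1/2\<close> as the midpoint of the segment, this is
  the cancellation that gains the second order.\<close>

lemma integral_near_linear:
  fixes F :: "real \<Rightarrow> real"
  assumes "F integrable_on {0..1}" and "\<And>r. r \<in> {0..1} \<Longrightarrow> \<bar>F r - (c + d * (2 * r - 1))\<bar> \<le> B"
  shows "\<bar>integral {0..1} F - c\<bar> \<le> B"
proof -
  have "((\<lambda>r. c + d * (2 * r - 1)) has_integral (c * 1 + d * (1\<^sup>2 - 1)) - (c * 0 + d * (0\<^sup>2 - 0))) {0..1::real}"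
    by (rule fundamental_theorem_of_calculus)
      (auto intro!: derivative_eq_intros simp: algebra_simps simp flip: has_real_derivative_iff_has_vector_derivative)
  then have lin: "((\<lambda>r. F r - (c + d * (2 * r - 1))) has_integral integral {0..1} F - c) {0..1}"
    using has_integral_diff[OF integrable_integral[OF assms(1)]] by fastforce
  have "norm (integral {0..1} (\<lambda>r. F r - (c + d * (2 * r - 1)))) \<le> integral {0..1::real} (\<lambda>r. B)"
    using lin assms(2) by (intro integral_norm_bound_integral) auto
  then show ?thesis
    using integral_unique[OF lin] by simp
qed

text \<open>Taylor expansion of \<open>\<gamma> = 1/M\<close> and \<open>\<gamma>'\<close> about the midpoint under the integral shows that the
  average \<open>J\<close> of \<open>\<gamma>\<close> is accurate about the midpoint, with \<open>\<gamma>\<close> in place of \<open>M\<close>. As \<open>J\<close> and \<open>\<gamma>\<close> are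
  bounded away from \<open>0\<close>, this passes to the reciprocals \<open>1/J\<close> and \<open>M = 1/\<gamma>\<close>.\<close>

lemma BEM_midpoint_accurate:
  assumes "a > 0" and pos: "\<And>s. s > 0 \<Longrightarrow> M s > 0"
    and M: "\<And>s. s > 0 \<Longrightarrow> (M has_real_derivative M' s) (at s)" and M': "C_k_on 3 M' {0<..}"
  shows "midpoint_accurate a b M M' (BEM_mobility M)"
proof -
  obtain M2 where M2: "\<And>s. s > 0 \<Longrightarrow> (M' has_real_derivative M2 s) (at s)" "C_k_on 2 M2 {0<..}"
    using C_k_on_real_deriv[of 2 M' "{0<..}"] M' unfolding greaterThan_iff numeral_3_eq_3 numeral_2_eq_2 by blast
  obtain M3 where M3: "\<And>s. s > 0 \<Longrightarrow> (M2 has_real_derivative M3 s) (at s)" "C_k_on 1 M3 {0<..}"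
    using C_k_on_real_deriv[of 1 M2 "{0<..}"] M2(2) unfolding greaterThan_iff numeral_2_eq_2 One_nat_def by blast
  have continuous: "continuous_on {0<..} f"
    if "\<And>s. s > 0 \<Longrightarrow> (f has_real_derivative f' s) (at s)" for f f' :: "real \<Rightarrow> real"
    by (rule DERIV_continuous_on[where D = f'], rule has_field_derivative_at_within, rule that) simp
  note contM = continuous[OF M]
  have contM1: "continuous_on {0<..} M'" and contM2: "continuous_on {0<..} M2" and contM3: "continuous_on {0<..} M3"
    using C_k_on_imp_continuous_on M' M2(2) M3(2) by blast+
  define \<gamma> where "\<gamma> = (\<lambda>s. 1 / M s)"
  define \<gamma>1 where "\<gamma>1 = (\<lambda>s. - M' s / (M s)\<^sup>2)"
  define \<gamma>2 where "\<gamma>2 = (\<lambda>s. (2 * (M' s)\<^sup>2 - M s * M2 s) / (M s)^3)"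
  define \<gamma>3 where "\<gamma>3 = (\<lambda>s. ((3 * M' s * M2 s - M s * M3 s) * (M s)^3
      - (2 * (M' s)\<^sup>2 - M s * M2 s) * (3 * (M s)\<^sup>2 * M' s)) / (M s)^6)"
  have \<gamma>: "(\<gamma> has_real_derivative \<gamma>1 s) (at s)" if "s > 0" for s
    unfolding \<gamma>_def \<gamma>1_def using pos[OF that] M[OF that]
    by (auto intro!: derivative_eq_intros simp: power2_eq_square)
  have \<gamma>1: "(\<gamma>1 has_real_derivative \<gamma>2 s) (at s)" if "s > 0" for s
    unfolding \<gamma>1_def \<gamma>2_def using pos[OF that] M[OF that] M2(1)[OF that]
    by (auto intro!: derivative_eq_intros simp: field_simps power2_eq_square power3_eq_cube)
  have \<gamma>2: "(\<gamma>2 has_real_derivative \<gamma>3 s) (at s)" if "s > 0" for s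
  proof -
    have "((\<lambda>s. 2 * (M' s)\<^sup>2 - M s * M2 s) has_real_derivative 3 * M' s * M2 s - M s * M3 s) (at s)"
      using M[OF that] M2(1)[OF that] M3(1)[OF that]
      by (auto intro!: derivative_eq_intros simp: algebra_simps)
    moreover have "((\<lambda>s. (M s)^3) has_real_derivative 3 * (M s)\<^sup>2 * M' s) (at s)"
      using M[OF that] by (auto intro!: derivative_eq_intros)
    moreover have "(M s)^6 = (M s)^3 * (M s)^3"
      by (simp flip: power_add)
    ultimately show ?thesis
      unfolding \<gamma>2_def \<gamma>3_def using pos[OF that] DERIV_divide by fastforce
  qed
  note cont = continuous[OF \<gamma>] continuous[OF \<gamma>1] continuous[OF \<gamma>2]
  have "M s \<noteq> 0" if "s > 0" for s
    using pos[OF that] by simp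
  then have cont3: "continuous_on {0<..} \<gamma>3"
    unfolding \<gamma>3_def by (intro continuous_intros contM contM1 contM2 contM3) auto
  have sub: "{a..b} \<subseteq> {0<..}" and sub': "\<And>s. s \<in> {a..b} \<Longrightarrow> s > 0"
    using \<open>a > 0\<close> by auto
  obtain K1 where K1: "K1 \<ge> 0" "\<And>s. s \<in> {a..b} \<Longrightarrow> \<bar>\<gamma>1 s\<bar> \<le> K1"
    using continuous_bounded_on[OF cont(2) compact_Icc sub] by metis
  obtain K2 where K2: "K2 \<ge> 0" "\<And>s. s \<in> {a..b} \<Longrightarrow> \<bar>\<gamma>2 s\<bar> \<le> K2"
    using continuous_bounded_on[OF cont(3) compact_Icc sub] by metis
  obtain K3 where K3: "K3 \<ge> 0" "\<And>s. s \<in> {a..b} \<Longrightarrow> \<bar>\<gamma>3 s\<bar> \<le> K3"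
    using continuous_bounded_on[OF cont3 compact_Icc sub] by metis
  define K where "K = K2 + K3"
  have K: "K \<ge> 0" "\<And>s. s \<in> {a..b} \<Longrightarrow> \<bar>\<gamma>2 s\<bar> \<le> K" "\<And>s. s \<in> {a..b} \<Longrightarrow> \<bar>\<gamma>3 s\<bar> \<le> K"
    using K2 K3 unfolding K_def by (auto simp: add_increasing add_increasing2)
  obtain c where c: "c > 0" "\<And>s. s \<in> {a..b} \<Longrightarrow> c \<le> \<gamma> s"
    using continuous_positive_bound[OF cont(1) compact_Icc sub] pos sub' unfolding \<gamma>_def
    by (metis divide_pos_pos zero_less_one)
  let ?J = "mean_resistance \<gamma>"
  note segment = affine_in_Icc[of _ _ a b]
  have integrable: "(\<lambda>r. \<gamma> (s1 + r * (s2 - s1))) integrable_on {0..1}" if "s1 \<in> {a..b}" "s2 \<in> {a..b}" for s1 s2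
  proof (rule integrable_continuous_real)
    show "continuous_on {0..1} (\<lambda>r. \<gamma> (s1 + r * (s2 - s1)))"
      by (rule continuous_on_compose2[OF cont(1)]) (auto intro!: continuous_intros sub' segment that)
  qed
  have J_ge: "c \<le> ?J s1 s2" if "s1 \<in> {a..b}" "s2 \<in> {a..b}" for s1 s2
  proof -
    have "integral {0..1::real} (\<lambda>r. c) \<le> ?J s1 s2"
      unfolding mean_resistance_def by (rule integral_le) (auto intro!: c segment integrable that)
    then show ?thesis by simp
  qed
  have deviation: "\<bar>s1 + r * (s2 - s1) - (s1 + s2) / 2\<bar> \<le> \<bar>s2 - s1\<bar>"
    if "r \<in> {0..1}" for r s1 s2 :: real
  proof -
    have "s1 + r * (s2 - s1) - (s1 + s2) / 2 = (2 * r - 1) / 2 * (s2 - s1)"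
      by (simp add: field_simps)
    moreover have "\<bar>(2 * r - 1) / 2\<bar> * \<bar>s2 - s1\<bar> \<le> 1 * \<bar>s2 - s1\<bar>"
      using that by (intro mult_right_mono) auto
    ultimately show ?thesis by (simp only: abs_mult mult_1)
  qed
  have J_near: "\<bar>?J s1 s2 - \<gamma> ((s1 + s2) / 2)\<bar> \<le> K * (s2 - s1)\<^sup>2" if s: "s1 \<in> {a..b}" "s2 \<in> {a..b}" for s1 s2
    unfolding mean_resistance_def
  proof (rule integral_near_linear[OF integrable[OF s], where d = "\<gamma>1 ((s1 + s2) / 2) * ((s2 - s1) / 2)"])
    fix r :: real assume r: "r \<in> {0..1}"
    let ?\<sigma> = "(s1 + s2) / 2" and ?s = "s1 + r * (s2 - s1)"
    have w: "?s - ?\<sigma> = (2 * r - 1) * ((s2 - s1) / 2)"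
      by (simp add: field_simps)
    have "(?s - ?\<sigma>)\<^sup>2 \<le> (s2 - s1)\<^sup>2"
      using deviation[OF r] by (simp only: abs_le_square_iff)
    then have "K * (?s - ?\<sigma>)\<^sup>2 \<le> K * (s2 - s1)\<^sup>2"
      using K(1) by (rule mult_left_mono)
    moreover have "\<bar>\<gamma> ?s - \<gamma> ?\<sigma> - \<gamma>1 ?\<sigma> * (?s - ?\<sigma>)\<bar> \<le> K * (?s - ?\<sigma>)\<^sup>2"
      using s by (intro linearization_error[of a b \<gamma> \<gamma>1 \<gamma>2] \<gamma> \<gamma>1 sub' K segment r) auto
    moreover have "\<gamma> ?s - (\<gamma> ?\<sigma> + \<gamma>1 ?\<sigma> * ((s2 - s1) / 2) * (2 * r - 1)) = \<gamma> ?s - \<gamma> ?\<sigma> - \<gamma>1 ?\<sigma> * (?s - ?\<sigma>)"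
      unfolding w by simp
    ultimately show "\<bar>\<gamma> ?s - (\<gamma> ?\<sigma> + \<gamma>1 ?\<sigma> * ((s2 - s1) / 2) * (2 * r - 1))\<bar> \<le> K * (s2 - s1)\<^sup>2"
      by linarith
  qed
  have BEM: "BEM_mobility M s1 s2 = 1 / ?J s1 s2" if "s1 > 0" "s2 > 0" for s1 s2
    using BEM_mobility_eq[OF that] cont(1) unfolding \<gamma>_def by blast
  have mid_in: "(s1 + s2) / 2 \<in> {a..b}" if "s1 \<in> {a..b}" "s2 \<in> {a..b}" for s1 s2
    using that by auto
  have J_deriv: "\<exists>D. ((\<lambda>y. ?J (f y) (g y)) has_real_derivative D) (at y) \<and>
      \<bar>D - \<gamma>1 ((f y + g y) / 2) * ((f' y + g' y) / 2)\<bar>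
        \<le> K * ((g y - f y)\<^sup>2 * \<bar>f' y + g' y\<bar> + \<bar>g y - f y\<bar> * \<bar>g' y - f' y\<bar>)"
    if "C1_curve a b f f'" "C1_curve a b g g'" for f f' g g' y
  proof -
    define F where "F y r = \<gamma> (f y + r * (g y - f y))" for y r
    define F1 where "F1 y r = \<gamma>1 (f y + r * (g y - f y)) * (f' y + r * (g' y - f' y))" for y r
    have range: "f y \<in> {a..b}" "g y \<in> {a..b}"
      and f: "(f has_real_derivative f' y) (at y)" and g: "(g has_real_derivative g' y) (at y)" for y
      using that by (auto simp: C1_curve_def)
    have cont_fg: "continuous_on UNIV f" "continuous_on UNIV g"
      by (rule DERIV_continuous_on[OF f], rule DERIV_continuous_on[OF g])
    have cont_fg': "continuous_on UNIV f'" "continuous_on UNIV g'"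
      using that by (auto simp: C1_curve_def)
    have cont_fst: "continuous_on (UNIV \<times> {0..1::real}) (\<lambda>x. k (fst x))" if "continuous_on UNIV k" for k :: "real \<Rightarrow> real"
      by (rule continuous_on_compose2[OF that continuous_on_fst[OF continuous_on_id]]) simp
    have "continuous_on (UNIV \<times> {0..1}) (\<lambda>x. \<gamma>1 (f (fst x) + snd x * (g (fst x) - f (fst x))))"
      by (rule continuous_on_compose2[OF cont(2)])
        (auto intro!: continuous_intros cont_fst cont_fg sub' segment range)
    then have cont_F1: "continuous_on (UNIV \<times> {0..1}) (\<lambda>(y, r). F1 y r)"
      unfolding F1_def split_beta by (intro continuous_intros cont_fst cont_fg')
    have "((\<lambda>y. integral (cbox 0 1) (F y)) has_real_derivative integral (cbox 0 1) (F1 y)) (at y within UNIV)"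
    proof (rule leibniz_rule_field_derivative)
      fix y r :: real assume "r \<in> cbox 0 1"
      then have "f y + r * (g y - f y) > 0"
        using range by (intro sub' segment) auto
      then show "((\<lambda>y. F y r) has_real_derivative F1 y r) (at y within UNIV)"
        unfolding F_def F1_def
        by (intro DERIV_chain2[OF \<gamma>]) (auto intro!: derivative_eq_intros f g)
    next
      show "F y integrable_on cbox 0 1" for y
        unfolding F_def using integrable[OF range, of y y] by simp
      show "continuous_on (UNIV \<times> cbox 0 1) (\<lambda>(y, r). F1 y r)"
        using cont_F1 by simp
    qed auto
    then have "((\<lambda>y. ?J (f y) (g y)) has_real_derivative integral {0..1} (F1 y)) (at y)"
      by (simp add: F_def[abs_def] mean_resistance_def)
    moreover
    let ?\<sigma> = "(f y + g y) / 2" and ?\<rho> = "(g y - f y) / 2"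
    let ?\<sigma>1 = "(f' y + g' y) / 2" and ?\<rho>1 = "(g' y - f' y) / 2"
    have "\<bar>integral {0..1} (F1 y) - \<gamma>1 ?\<sigma> * ?\<sigma>1\<bar>
        \<le> K * ((g y - f y)\<^sup>2 * \<bar>f' y + g' y\<bar> + \<bar>g y - f y\<bar> * \<bar>g' y - f' y\<bar>)"
    \<comment> \<open>the coefficient of \<open>2 r - 1\<close> in the product of the first-order expansions of
      \<open>\<gamma>'\<close> and of the velocity of the point \<open>f + r (g - f)\<close>\<close>
    proof (rule integral_near_linear[where d = "\<gamma>1 ?\<sigma> * ?\<rho>1 + \<gamma>2 ?\<sigma> * ?\<rho> * ?\<sigma>1"])
      have "continuous_on {0..1} (\<lambda>r. (\<lambda>(y, r). F1 y r) (y, r))"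
        by (rule continuous_on_compose2[OF cont_F1]) (auto intro!: continuous_intros)
      then show "F1 y integrable_on {0..1}"
        by (intro integrable_continuous_real) simp
    next
      fix r :: real assume r: "r \<in> {0..1}"
      let ?s = "f y + r * (g y - f y)"
      define w where "w = ?s - ?\<sigma>"
      have w: "w = (2 * r - 1) * ?\<rho>" "\<bar>w\<bar> \<le> \<bar>g y - f y\<bar>"
        using deviation[OF r, of "f y" "g y"] by (auto simp: w_def field_simps)
      have in_ab: "?s \<in> {a..b}" "?\<sigma> \<in> {a..b}"
        by (auto intro!: segment[OF r] mid_in range simp del: atLeastAtMost_iff)
      have lin: "\<bar>\<gamma>1 ?s - \<gamma>1 ?\<sigma> - \<gamma>2 ?\<sigma> * w\<bar> \<le> K * w\<^sup>2"
        unfolding w_def by (rule linearization_error[OF \<gamma>1 \<gamma>2 K(3) in_ab(2,1)]) (auto intro: sub')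
      have "w\<^sup>2 \<le> (g y - f y)\<^sup>2"
        using w(2) by (simp add: abs_le_square_iff)
      then have lin': "\<bar>\<gamma>1 ?s - \<gamma>1 ?\<sigma> - \<gamma>2 ?\<sigma> * w\<bar> \<le> K * (g y - f y)\<^sup>2"
        using lin mult_left_mono[OF _ K(1)] by (meson order_trans)
      have "norm (\<gamma>1 ?s - \<gamma>1 ?\<sigma>) \<le> K * norm (?s - ?\<sigma>)"
        by (rule field_differentiable_bound[of "{a..b}" \<gamma>1 \<gamma>2])
          (use \<gamma>1 K(2) sub' in_ab in \<open>auto intro: has_field_derivative_at_within simp del: atLeastAtMost_iff\<close>)
      also have "\<dots> \<le> K * \<bar>g y - f y\<bar>"
        using w(2) K(1) by (simp add: w_def mult_left_mono)
      finally have lip: "\<bar>\<gamma>1 ?s - \<gamma>1 ?\<sigma>\<bar> \<le> K * \<bar>g y - f y\<bar>" by simp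
      have "\<bar>(2 * r - 1) * ?\<rho>1\<bar> \<le> 1 * \<bar>g' y - f' y\<bar>"
        unfolding abs_mult using r by (intro mult_mono) auto
      then have offset: "\<bar>(2 * r - 1) * ?\<rho>1\<bar> \<le> \<bar>g' y - f' y\<bar>"
        by (simp only: mult_1)
      have b2: "\<bar>(\<gamma>1 ?s - \<gamma>1 ?\<sigma>) * ((2 * r - 1) * ?\<rho>1)\<bar> \<le> (K * \<bar>g y - f y\<bar>) * \<bar>g' y - f' y\<bar>"
        by (subst abs_mult, rule mult_mono[OF lip offset]) (use K(1) in auto)
      have b1: "\<bar>(\<gamma>1 ?s - \<gamma>1 ?\<sigma> - \<gamma>2 ?\<sigma> * w) * ?\<sigma>1\<bar> \<le> (K * (g y - f y)\<^sup>2) * \<bar>f' y + g' y\<bar>"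
        unfolding abs_mult using K(1) by (intro mult_mono lin') auto
      have split: "F1 y r - (\<gamma>1 ?\<sigma> * ?\<sigma>1 + (\<gamma>1 ?\<sigma> * ?\<rho>1 + \<gamma>2 ?\<sigma> * ?\<rho> * ?\<sigma>1) * (2 * r - 1))
          = (\<gamma>1 ?s - \<gamma>1 ?\<sigma> - \<gamma>2 ?\<sigma> * w) * ?\<sigma>1 + (\<gamma>1 ?s - \<gamma>1 ?\<sigma>) * ((2 * r - 1) * ?\<rho>1)"
      proof -
        have "f' y + r * (g' y - f' y) = ?\<sigma>1 + (2 * r - 1) * ?\<rho>1"
          by (simp add: field_simps)
        then have "F1 y r = \<gamma>1 ?s * (?\<sigma>1 + (2 * r - 1) * ?\<rho>1)"
          unfolding F1_def by simp
        moreover have "x * (s + z * q) - (y * s + (y * q + y' * p * s) * z)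
            = (x - y - y' * (z * p)) * s + (x - y) * (z * q)" for x y y' s q p z :: real
          by (simp add: algebra_simps)
        ultimately show ?thesis
          unfolding w(1) by metis
      qed
      have K_eq: "K * ((g y - f y)\<^sup>2 * \<bar>f' y + g' y\<bar> + \<bar>g y - f y\<bar> * \<bar>g' y - f' y\<bar>)
          = (K * (g y - f y)\<^sup>2) * \<bar>f' y + g' y\<bar> + (K * \<bar>g y - f y\<bar>) * \<bar>g' y - f' y\<bar>"
        by (simp add: algebra_simps)
      show "\<bar>F1 y r - (\<gamma>1 ?\<sigma> * ?\<sigma>1 + (\<gamma>1 ?\<sigma> * ?\<rho>1 + \<gamma>2 ?\<sigma> * ?\<rho> * ?\<sigma>1) * (2 * r - 1))\<bar>
          \<le> K * ((g y - f y)\<^sup>2 * \<bar>f' y + g' y\<bar> + \<bar>g y - f y\<bar> * \<bar>g' y - f' y\<bar>)"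
        unfolding split K_eq by (rule order_trans[OF abs_triangle_ineq add_mono[OF b1 b2]])
    qed
    ultimately show ?thesis by blast
  qed
  define C where "C = K / c\<^sup>2 + 2 * K1 * K / c^3"
  have C: "C \<ge> 0" "K / c\<^sup>2 \<le> C"
    using K(1) K1(1) c(1) by (auto simp: C_def)
  show ?thesis
    unfolding midpoint_accurate_def
  proof (rule exI[of _ C], intro conjI ballI allI impI)
    show "0 \<le> C" by (rule C(1))
    fix s1 s2 assume s: "s1 \<in> {a..b}" "s2 \<in> {a..b}"
    let ?\<sigma> = "(s1 + s2) / 2"
    have ge: "c \<le> ?J s1 s2" "c \<le> \<gamma> ?\<sigma>" and M_eq: "M ?\<sigma> = 1 / \<gamma> ?\<sigma>"
      using J_ge[OF s] c(2)[OF mid_in[OF s]] by (auto simp: \<gamma>_def)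
    have "\<bar>BEM_mobility M s1 s2 - M ?\<sigma>\<bar> = \<bar>?J s1 s2 - \<gamma> ?\<sigma>\<bar> / (?J s1 s2 * \<gamma> ?\<sigma>)"
      using ge c(1) unfolding BEM[OF sub'[OF s(1)] sub'[OF s(2)]] M_eq
      by (auto simp: field_simps abs_if)
    also have "\<dots> \<le> K * (s2 - s1)\<^sup>2 / (c * c)"
      using ge c(1) J_near[OF s] by (intro frac_le mult_mono) auto
    also have "\<dots> \<le> C * (s2 - s1)\<^sup>2"
      using mult_right_mono[OF C(2), of "(s2 - s1)\<^sup>2"] by (simp add: power2_eq_square)
    finally show "\<bar>BEM_mobility M s1 s2 - M ?\<sigma>\<bar> \<le> C * (s2 - s1)\<^sup>2" .
  next
    fix f f' g g' y
    assume curves: "C1_curve a b f f' \<and> C1_curve a b g g'"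
    then have range: "f y \<in> {a..b}" "g y \<in> {a..b}" for y
      by (auto simp: C1_curve_def)
    obtain D where D: "((\<lambda>y. ?J (f y) (g y)) has_real_derivative D) (at y)"
      and D_bound: "\<bar>D - \<gamma>1 ((f y + g y) / 2) * ((f' y + g' y) / 2)\<bar>
        \<le> K * ((g y - f y)\<^sup>2 * \<bar>f' y + g' y\<bar> + \<bar>g y - f y\<bar> * \<bar>g' y - f' y\<bar>)"
      using J_deriv curves by blast
    define j where "j = ?J (f y) (g y)"
    define k where "k = \<gamma> ((f y + g y) / 2)"
    define k1 where "k1 = \<gamma>1 ((f y + g y) / 2)"
    define \<sigma>1 where "\<sigma>1 = (f' y + g' y) / 2"
    define E1 where "E1 = (g y - f y)\<^sup>2 * \<bar>f' y + g' y\<bar>"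
    define E2 where "E2 = \<bar>g y - f y\<bar> * \<bar>g' y - f' y\<bar>"
    have E: "E1 \<ge> 0" "E2 \<ge> 0"
      by (auto simp: E1_def E2_def)
    have j: "c \<le> j" and k: "c \<le> k" and jk: "\<bar>j - k\<bar> \<le> K * (g y - f y)\<^sup>2" and k1: "\<bar>k1\<bar> \<le> K1"
      using J_ge[OF range] c(2)[OF mid_in[OF range]] J_near[OF range] K1(2)[OF mid_in[OF range]]
      by (auto simp: j_def k_def k1_def)
    have M'_eq: "M' ((f y + g y) / 2) = - k1 / k\<^sup>2"
      using pos[OF sub'[OF mid_in[OF range]], of y y] by (simp add: k_def k1_def \<gamma>_def \<gamma>1_def power_divide)
    have eq: "(\<lambda>y. BEM_mobility M (f y) (g y)) = (\<lambda>y. 1 / ?J (f y) (g y))"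
      using BEM[OF sub' sub'] range by blast
    have "j \<noteq> 0" using j c(1) by auto
    then have "((\<lambda>y. BEM_mobility M (f y) (g y)) has_real_derivative - D / j\<^sup>2) (at y)"
      unfolding eq j_def by (auto intro!: derivative_eq_intros D simp: power2_eq_square)
    moreover have "\<bar>- D / j\<^sup>2 - M' ((f y + g y) / 2) * \<sigma>1\<bar> \<le> C * (E1 + E2)"
    proof -
      have split: "- D / j\<^sup>2 - M' ((f y + g y) / 2) * \<sigma>1 = - ((D - k1 * \<sigma>1) / j\<^sup>2) + k1 * \<sigma>1 * (j - k) * (j + k) / (j\<^sup>2 * k\<^sup>2)"
        unfolding M'_eq using j k c(1) by (simp add: field_simps power2_eq_square)
      have dJ: "\<bar>(D - k1 * \<sigma>1) / j\<^sup>2\<bar> \<le> K * (E1 + E2) / c\<^sup>2"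
        using D_bound j c(1) K(1) E unfolding abs_divide E1_def[symmetric] E2_def[symmetric] k1_def[symmetric] \<sigma>1_def[symmetric]
        by (intro frac_le) (auto simp: power_mono)
      have dk: "\<bar>k1 * \<sigma>1 * (j - k) * (j + k) / (j\<^sup>2 * k\<^sup>2)\<bar> \<le> (2 * K1 * K / c^3) * E1"
      proof -
        have "(j + k) / (j\<^sup>2 * k\<^sup>2) = 1 / (j * k\<^sup>2) + 1 / (j\<^sup>2 * k)"
          using j k c(1) by (simp add: field_simps power2_eq_square)
        also have "\<dots> \<le> 1 / (c * c\<^sup>2) + 1 / (c\<^sup>2 * c)"
          using j k c(1) by (intro add_mono divide_left_mono mult_mono power_mono) auto
        also have "\<dots> = 2 / c^3"
          by (simp add: power2_eq_square power3_eq_cube)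
        finally have frac: "(j + k) / (j\<^sup>2 * k\<^sup>2) \<le> 2 / c^3" .
        have "\<bar>\<sigma>1\<bar> * \<bar>j - k\<bar> \<le> \<bar>f' y + g' y\<bar> * (K * (g y - f y)\<^sup>2)"
          by (intro mult_mono jk) (auto simp: \<sigma>1_def)
        then have mean: "\<bar>\<sigma>1\<bar> * \<bar>j - k\<bar> \<le> K * E1"
          by (simp add: E1_def mult.commute mult.left_commute)
        have "\<bar>k1\<bar> * (\<bar>\<sigma>1\<bar> * \<bar>j - k\<bar>) * ((j + k) / (j\<^sup>2 * k\<^sup>2)) \<le> K1 * (K * E1) * (2 / c^3)"
          by (rule mult_mono[OF mult_mono[OF k1 mean] frac]) (use K1(1) K(1) E j k c(1) in auto)
        moreover have "\<bar>k1 * \<sigma>1 * (j - k) * (j + k) / (j\<^sup>2 * k\<^sup>2)\<bar> = \<bar>k1\<bar> * (\<bar>\<sigma>1\<bar> * \<bar>j - k\<bar>) * ((j + k) / (j\<^sup>2 * k\<^sup>2))"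
          using j k c(1) by (simp add: abs_mult)
        moreover have "K1 * (K * E1) * (2 / c^3) = (2 * K1 * K / c^3) * E1"
          by simp
        ultimately show ?thesis by linarith
      qed
      have rest: "0 \<le> (2 * K1 * K / c^3) * E2"
        using K1(1) K(1) E c(1) by auto
      have C_eq: "C * (E1 + E2) = K * (E1 + E2) / c\<^sup>2 + (2 * K1 * K / c^3) * E1 + (2 * K1 * K / c^3) * E2"
        by (simp add: C_def algebra_simps add_divide_distrib)
      have "\<bar>- p + q\<bar> \<le> x + y + z" if "\<bar>p\<bar> \<le> x" "\<bar>q\<bar> \<le> y" "0 \<le> z" for p q x y z :: real
        using that by linarith
      from this[OF dJ dk rest] show ?thesis
        unfolding split C_eq .
    qed
    ultimately show "\<exists>D. ((\<lambda>y. BEM_mobility M (f y) (g y)) has_real_derivative D) (at y) \<and>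
        \<bar>D - M' ((f y + g y) / 2) * ((f' y + g' y) / 2)\<bar>
          \<le> C * ((g y - f y)\<^sup>2 * \<bar>f' y + g' y\<bar> + \<bar>g y - f y\<bar> * \<bar>g' y - f' y\<bar>)"
      unfolding \<sigma>1_def E1_def E2_def by blast
  qed
qed


section \<open>Bounds and boundary values for periodic functions\<close>

lemma periodic_int:
  fixes f :: "real \<Rightarrow> 'a"
  assumes "\<And>x. f (x + L) = f x"
  shows "f (x + of_int k * L) = f x"
proof (induction k rule: int_induct[of _ 0])
  case base
  then show ?case by simp
next
  case (step1 i)
  then show ?case using assms[of "x + of_int i * L"] by (simp add: algebra_simps)
next
  case (step2 i)
  then show ?case using assms[of "x + of_int (i - 1) * L"] by (simp add: algebra_simps)
qed

lemma periodic_representative: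
  fixes x L :: real
  assumes "L > 0"
  obtains k :: int where "x + of_int k * L \<in> {0..<L}"
proof
  have "of_int \<lfloor>x / L\<rfloor> * L \<le> x" "x < (of_int \<lfloor>x / L\<rfloor> + 1) * L"
    using assms floor_divide_lower[of L x] floor_divide_upper[of L x] by auto
  then show "x + of_int (- \<lfloor>x / L\<rfloor>) * L \<in> {0..<L}"
    by (auto simp: algebra_simps)
qed

lemma periodic_derivative:
  fixes f :: "real \<Rightarrow> real"
  assumes "\<And>x. f (x + L) = f x" and "\<And>x. (f has_real_derivative f' x) (at x)"
  shows "f' (x + L) = f' x"
proof -
  have "((\<lambda>x. f (x + L)) has_real_derivative f' (x + L)) (at x)"
    by (rule DERIV_shift[THEN iffD1, OF assms(2)])
  then have "(f has_real_derivative f' (x + L)) (at x)"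
    by (simp add: assms(1))
  then show ?thesis
    using assms(2) by (rule DERIV_unique)
qed

lemma periodic_deriv_iter:
  fixes f :: "real \<Rightarrow> real"
  assumes "\<And>x. f (x + L) = f x"
  shows "(deriv ^^ j) f (x + L) = (deriv ^^ j) f x"
proof (induction j arbitrary: x)
  case 0
  then show ?case using assms by simp
next
  case (Suc j)
  have "((deriv ^^ j) f has_real_derivative D) (at (x + L)) \<longleftrightarrow>
      ((deriv ^^ j) f has_real_derivative D) (at x)" for D
    unfolding DERIV_shift using Suc by simp
  then show ?case
    unfolding funpow.simps(2) o_apply deriv_def[of "(deriv ^^ j) f"] by simp
qed

text \<open>Periodicity reduces the bounds to the compact rectangle \<open>{0..L} \<times> {0..T}\<close>. The times \<open>I\<close> at which
  periodicity is known may form an open interval: for \<open>u\<^sub>t\<close> it is read off from two-sided derivatives.\<close>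

lemma C_k_space_bounded_derivs:
  assumes v: "C_k_space k T v" and "L > 0" and I: "I \<subseteq> {0..T}"
    and periodic: "\<And>t x. t \<in> I \<Longrightarrow> v (x + L) t = v x t"
  shows "bounded_derivs k I (\<lambda>t x. v x t)"
proof -
  define V where "V j t = (deriv ^^ j) (\<lambda>y. v y t)" for j t
  have bound: "bounded_derivs 0 I (V j)" if "j \<le> k" for j
  proof -
    have "continuous_on (UNIV \<times> {0..T}) (\<lambda>(x, t). V j t x)"
      using v that by (simp add: C_k_space_def V_def)
    moreover have "compact ({0..L} \<times> {0..T})"
      by (intro compact_Times compact_Icc)
    ultimately obtain K where K: "\<And>s. s \<in> {0..L} \<times> {0..T} \<Longrightarrow> \<bar>case s of (x, t) \<Rightarrow> V j t x\<bar> \<le> K"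
      using continuous_bounded_on[of "UNIV \<times> {0..T}" _ "{0..L} \<times> {0..T}"] by (metis Sigma_mono subset_UNIV subset_refl)
    have "\<bar>V j t x\<bar> \<le> K" if t: "t \<in> I" for t x
    proof -
      obtain l where l: "x + of_int l * L \<in> {0..<L}"
        using periodic_representative[OF \<open>L > 0\<close>] by metis
      have "V j t (x + of_int l * L) = V j t x"
        unfolding V_def by (intro periodic_int periodic_deriv_iter periodic t)
      then show ?thesis
        using K[of "(x + of_int l * L, t)"] l t I by auto
    qed
    then show ?thesis by auto
  qed
  have deriv: "(V j t has_real_derivative V (Suc j) t x) (at x)" if "j < k" "t \<in> I" for j t x
  proof -
    have "V j t differentiable (at x)"
      using v that I unfolding V_def C_k_space_def by blast
    then show ?thesis
      unfolding V_def funpow.simps(2) o_apply by (simp add: DERIV_deriv_iff_real_differentiable)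
  qed
  have "bounded_derivs n I (V (k - n))" if "n \<le> k" for n
    using that
  proof (induction n)
    case 0
    show ?case by (rule bound) simp
  next
    case (Suc n)
    then have deriv_bounded: "bounded_derivs n I (V (Suc (k - Suc n)))"
      by (simp add: Suc_diff_Suc)
    have "(V (k - Suc n) t has_real_derivative V (Suc (k - Suc n)) t x) (at x)" if "t \<in> I" for t x
      using Suc.prems that by (intro deriv) auto
    then show ?case
      by (rule bounded_derivs_SucI[OF bound[OF diff_le_self] _ deriv_bounded])
  qed
  from this[of k] show ?thesis
    by (simp add: V_def[abs_def])
qed

text \<open>A derivative has no jumps, by the mean value theorem. This carries the differential equation, posed
  on the open interval from \<open>0\<close> to \<open>L\<close>, to the point \<open>0\<close> where the periods are glued, without knowing
  that \<open>F'\<close> is continuous.\<close>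

lemma derivative_eq_right_limit:
  fixes F :: "real \<Rightarrow> real"
  assumes F: "(F has_real_derivative D) (at x)"
    and W: "\<And>y. y \<in> {x<..<b} \<Longrightarrow> (F has_real_derivative W y) (at y)"
    and "x < b" and cont: "continuous (at x) W"
  shows "D = W x"
proof -
  let ?q = "\<lambda>y. (F y - F x) / (y - x)"
  have "(?q \<longlongrightarrow> D) (at_right x)"
    using F by (auto simp: has_field_derivative_iff intro: filterlim_mono at_le)
  moreover have "(?q \<longlongrightarrow> W x) (at_right x)"
  proof (rule tendstoI)
    fix e :: real assume "e > 0"
    then obtain d where d: "d > 0" "\<And>y. dist y x < d \<Longrightarrow> dist (W y) (W x) < e"
      using cont unfolding continuous_at_eps_delta by blast
    have "dist (?q y) (W x) < e" if y: "x < y" "y < min b (x + d)" for y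
    proof -
      obtain z where z: "x < z" "z < y" "F y - F x = (y - x) * (if z = x then D else W z)"
        using MVT2[OF y(1), of F "\<lambda>z. if z = x then D else W z"] F W y by force
      then have "?q y = W z" by auto
      then show ?thesis using d(2)[of z] z y by (auto simp: dist_real_def)
    qed
    then show "\<forall>\<^sub>F y in at_right x. dist (?q y) (W x) < e"
      unfolding eventually_at_right_field using \<open>x < b\<close> d(1)
      by (intro exI[of _ "min b (x + d)"]) auto
  qed
  ultimately show ?thesis
    by (rule tendsto_unique[OF trivial_limit_at_right_real])
qed

section \<open>Consistency\<close>

lemma truncation_error_cdiff:
  assumes "h > 0"
  shows "truncation_error \<alpha> Zp Zm m h u i t =
    (1 + \<alpha> * u (of_int i * h) t) * deriv (u (of_int i * h)) t
    + cdiff h (\<lambda>y. m (u (y - h / 2) t) (u (y + h / 2) t) *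
        (1 + cdiff h (\<lambda>z. cdiff h (cdiff h (\<lambda>y. u y t)) z - Zp (u z t) - Zm (u z t)) y))
      (of_int i * h)"
proof -
  define c where "c = cdiff h (cdiff h (\<lambda>y. u y t))"
  have next_point: "of_int (j + 1) * h = of_int j * h + h" and prev_point: "of_int (j - 1) * h = of_int j * h - h" for j
    by (simp_all add: algebra_simps)
  have half: "y + h / 2 + h / 2 = y + h" "y - h / 2 - h / 2 = y - h" for y
    by simp_all
  have pressure: "discrete_pressure Zp Zm h (\<lambda>l. u (of_int l * h) t) j =
      c (of_int j * h) - Zp (u (of_int j * h) t) - Zm (u (of_int j * h) t)" for j
    unfolding discrete_pressure_def fwd_diff_def bwd_diff_def c_def cdiff_def next_point prev_point half
    by simp
  show ?thesis
    unfolding truncation_error_def scheme_residual_def pressure fwd_diff_def bwd_diff_def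
      next_point prev_point c_def[symmetric]
    by (simp add: cdiff_def half)
qed

text \<open>In the proof \<open>F\<close> is the exact flux, \<open>W = - (1 + \<alpha> u) u\<^sub>t\<close> its derivative, and \<open>e\<close>, \<open>\<phi>\<close>,
  \<open>\<epsilon>\<close>, \<open>\<rho>\<close> and \<open>q\<close> are the remainders, divided by \<open>h\<^sup>2\<close>, of the mobility, the second
  difference of \<open>u\<close>, the pressure gradient, the flux and the flux difference. The remainder called
  \<open>r\<close> in the introduction is \<open>\<rho>\<close>; its derivative is what makes \<open>q\<close> bounded.\<close>

lemma midpoint_accurate_imp_second_order_consistent:
  assumes "L > 0"
    and M: "C_k_on 4 M {0<..}" "\<And>s. s > 0 \<Longrightarrow> M s > 0"
    and M': "\<And>s. s > 0 \<Longrightarrow> (M has_real_derivative M' s) (at s)" "C_k_on 3 M' {0<..}"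
    and Zp: "C_k_on 2 Zp {0<..}" and Zm: "C_k_on 2 Zm {0<..}"
    and sol: "smooth_solution_P L T \<alpha> M Zp Zm u0 u"
    and mid: "\<And>a b. a > 0 \<Longrightarrow> midpoint_accurate a b M M' m"
  shows "second_order_consistent L T \<alpha> Zp Zm m u"
proof -
  define I where "I = {0<..<T}"
  have u_smooth: "C_k_space 6 T u"
    and u_periodic: "\<And>x t. t \<in> {0..T} \<Longrightarrow> u (x + L) t = u x t"
    and u_pos: "\<And>x t. t \<in> {0..T} \<Longrightarrow> u x t > 0"
    and pde: "\<And>x t. x \<in> {0<..<L} \<Longrightarrow> t \<in> {0<..<T} \<Longrightarrow>
        deriv (\<lambda>s. u x s + \<alpha> / 2 * (u x s)\<^sup>2) t
        + deriv (\<lambda>y. M (u y t) * (1 + deriv (\<lambda>z. pressure Zp Zm u z t) y)) x = 0"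
    using sol unfolding smooth_solution_P_def smooth_spacetime_def by blast+
  obtain ut where ut_smooth: "C_k_space 2 T ut"
    and ut_within: "\<And>x t. t \<in> {0..T} \<Longrightarrow> ((\<lambda>s. u x s) has_real_derivative ut x t) (at t within {0..T})"
    using sol unfolding smooth_solution_P_def smooth_spacetime_def by blast
  have I: "I \<subseteq> {0..T}" and I_D: "\<And>t. t \<in> I \<Longrightarrow> t \<in> {0..T}"
    by (auto simp: I_def)
  have ut: "(u x has_real_derivative ut x t) (at t)" if "t \<in> I" for x t
    using ut_within[OF I_D[OF that], of x] that by (simp add: I_def at_within_Icc_at)
  have ut_periodic: "ut (x + L) t = ut x t" if t: "t \<in> I" for x t
  proof (rule DERIV_unique[OF _ ut[OF t]])
    show "(u x has_real_derivative ut (x + L) t) (at t)"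
      by (rule has_field_derivative_transform_within_open[OF ut[OF t, of "x + L"], of I])
        (use t u_periodic I_D in \<open>auto simp: I_def\<close>)
  qed
  have u6: "bounded_derivs 6 I (\<lambda>t x. u x t)"
    by (rule C_k_space_bounded_derivs[OF u_smooth \<open>L > 0\<close> I u_periodic[OF I_D]])
  have ut2: "bounded_derivs 2 I (\<lambda>t x. ut x t)"
    by (rule C_k_space_bounded_derivs[OF ut_smooth \<open>L > 0\<close> I ut_periodic])

  obtain a b where "a > 0" and range: "\<And>t x. t \<in> I \<Longrightarrow> u x t \<in> {a..b}"
  proof -
    have "\<forall>j\<le>6. continuous_on (UNIV \<times> {0..T}) (\<lambda>(x, t). (deriv ^^ j) (\<lambda>y. u y t) x)"
      using u_smooth by (simp add: C_k_space_def)
    from this[rule_format, of 0] have cont: "continuous_on (UNIV \<times> {0..T}) (\<lambda>(x, t). u x t)"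
      by simp
    obtain a where a: "a > 0" "\<And>s. s \<in> {0..L} \<times> {0..T} \<Longrightarrow> a \<le> (\<lambda>(x, t). u x t) s"
    proof (rule continuous_positive_bound[OF cont])
      show "compact ({0..L} \<times> {0..T})"
        by (intro compact_Times compact_Icc)
    qed (use u_pos in auto)
    obtain b where b: "\<And>t x. t \<in> I \<Longrightarrow> \<bar>u x t\<bar> \<le> b"
      using bounded_derivs_bound[OF u6] by metis
    have "a \<le> u x t" if t: "t \<in> I" for x t
    proof -
      obtain l where l: "x + of_int l * L \<in> {0..<L}"
        using periodic_representative[OF \<open>L > 0\<close>] by metis
      then have "a \<le> u (x + of_int l * L) t"
        using a(2)[of "(x + of_int l * L, t)"] I_D[OF t] by simp
      also have "\<dots> = u x t"
        using u_periodic[OF I_D[OF t]] by (rule periodic_int)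
      finally show ?thesis .
    qed
    then show ?thesis
      using that[OF a(1), of b] b by (metis abs_le_D1 atLeastAtMost_iff)
  qed
  have sub: "{a..b} \<subseteq> {0<..}"
    using \<open>a > 0\<close> by auto

  have numeral_Suc: "(6::nat) = Suc 5" "(5::nat) = Suc 4" by simp_all
  obtain u1 where u1: "\<And>t x. t \<in> I \<Longrightarrow> ((\<lambda>x. u x t) has_real_derivative u1 t x) (at x)"
      "bounded_derivs 5 I u1"
    using u6 unfolding numeral_Suc(1) bounded_derivs.simps(2)[of 5] by metis
  obtain u2 where u2: "\<And>t x. t \<in> I \<Longrightarrow> (u1 t has_real_derivative u2 t x) (at x)"
      "bounded_derivs 4 I u2"
    using u1(2) unfolding numeral_Suc(2) bounded_derivs.simps(2)[of 4] by metis
  have deriv2: "(deriv ^^ 2) (\<lambda>x. u x t) = u2 t" if t: "t \<in> I" for t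
  proof -
    have "deriv (\<lambda>x. u x t) = u1 t" "deriv (u1 t) = u2 t"
      using DERIV_imp_deriv[OF u1(1)[OF t]] DERIV_imp_deriv[OF u2(1)[OF t]] by auto
    then show ?thesis by (simp add: numeral_2_eq_2)
  qed
  have u1_periodic: "u1 t (x + L) = u1 t x" if "t \<in> I" for t x
    by (rule periodic_derivative[OF u_periodic[OF I_D[OF that]] u1(1)[OF that]])
  have u2_periodic: "u2 t (x + L) = u2 t x" if "t \<in> I" for t x
    by (rule periodic_derivative[OF u1_periodic[OF that] u2(1)[OF that]])

  define p where "p t x = u2 t x - Zp (u x t) - Zm (u x t)" for t x
  have p_eq: "pressure Zp Zm u x t = p t x" if "t \<in> I" for t x
    by (simp add: pressure_def p_def deriv2[OF that])
  have u_le: "bounded_derivs k I (\<lambda>t x. u x t)" if "k \<le> 6" for k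
    by (rule bounded_derivs_mono[OF u6 that])
  have u_2: "bounded_derivs 2 I (\<lambda>t x. u x t)"
    by (rule u_le) simp
  have u2_2: "bounded_derivs 2 I u2"
    by (rule bounded_derivs_mono[OF u2(2)]) simp
  have p2: "bounded_derivs 2 I p"
    unfolding p_def
    by (rule bounded_derivs_diff[OF bounded_derivs_diff[OF u2_2
          bounded_derivs_compose[OF Zp u_2 \<open>a > 0\<close> range]] bounded_derivs_compose[OF Zm u_2 \<open>a > 0\<close> range]])
  obtain p1 where p1: "\<And>t x. t \<in> I \<Longrightarrow> (p t has_real_derivative p1 t x) (at x)"
      "bounded_derivs 1 I p1"
    using p2 unfolding numeral_2_eq_2 One_nat_def by (metis bounded_derivs.simps(2)[of "Suc 0"])
  have p1_periodic: "p1 t (x + L) = p1 t x" if "t \<in> I" for t x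
    by (rule periodic_derivative[OF _ p1(1)[OF that]])
      (simp add: p_def u_periodic[OF I_D[OF that]] u2_periodic[OF that])

  have Mu: "bounded_derivs 4 I (\<lambda>t x. M (u x t))"
    by (rule bounded_derivs_compose[OF M(1) u_le \<open>a > 0\<close> range]) simp
  define F where "F t x = M (u x t) * (1 + p1 t x)" for t x
  define W where "W t x = - ((1 + \<alpha> * u x t) * ut x t)" for t x
  have F1: "bounded_derivs 1 I F"
  proof -
    have "bounded_derivs 1 I (\<lambda>t x. 1 + p1 t x)"
      by (rule bounded_derivs_add[OF bounded_derivs_const[where c = "\<lambda>t. 1" and K = 1] p1(2)]) simp
    moreover have "bounded_derivs 1 I (\<lambda>t x. M (u x t))"
      by (rule bounded_derivs_mono[OF Mu]) simp
    ultimately show ?thesis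
      unfolding F_def by (intro bounded_derivs_mult)
  qed
  obtain F' where F': "\<And>t x. t \<in> I \<Longrightarrow> (F t has_real_derivative F' t x) (at x)"
    using F1 unfolding One_nat_def by (metis bounded_derivs.simps(2))
  have W2: "bounded_derivs 2 I W"
  proof -
    have "bounded_derivs 2 I (\<lambda>t x. 1 + \<alpha> * u x t)"
      by (rule bounded_derivs_add[OF bounded_derivs_const[where c = "\<lambda>t. 1" and K = 1] bounded_derivs_cmult[OF u_2]]) simp
    from bounded_derivs_cmult[OF bounded_derivs_mult[OF this ut2], of "-1"]
    show ?thesis by (simp add: W_def[abs_def])
  qed
  \<comment> \<open>the differential equation, extended from one period to the whole line\<close>
  have F'_eq: "F' t x = W t x" if t: "t \<in> I" for t x
  proof -
    have inner: "F' t x = W t x" if x: "x \<in> {0<..<L}" for x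
    proof -
      have "((\<lambda>s. u x s + \<alpha> / 2 * (u x s)\<^sup>2) has_real_derivative (1 + \<alpha> * u x t) * ut x t) (at t)"
        by (auto intro!: derivative_eq_intros ut[OF t] simp: algebra_simps)
      moreover have "deriv (\<lambda>z. pressure Zp Zm u z t) = p1 t"
        using DERIV_imp_deriv[OF p1(1)[OF t]] by (simp add: p_eq[OF t] ext)
      then have "(\<lambda>y. M (u y t) * (1 + deriv (\<lambda>z. pressure Zp Zm u z t) y)) = F t"
        by (simp add: F_def[abs_def])
      ultimately show ?thesis
        using pde[OF x t[unfolded I_def]] DERIV_imp_deriv[OF F'[OF t]] by (simp add: DERIV_imp_deriv W_def)
    qed
    obtain W' where "(W t has_real_derivative W') (at 0)"
      using W2 t unfolding numeral_2_eq_2 bounded_derivs.simps(2)[of "Suc 0"] by metis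
    then have W_cont: "continuous (at 0) (W t)"
      by (rule DERIV_isCont)
    have zero: "F' t 0 = W t 0"
    proof (rule derivative_eq_right_limit[OF F'[OF t] _ \<open>L > 0\<close> W_cont])
      fix y assume "y \<in> {0<..<L}"
      then show "(F t has_real_derivative W t y) (at y)"
        using F'[OF t, of y] inner by simp
    qed
    have F'_periodic: "F' t (x + L) = F' t x" for x
      by (rule periodic_derivative[OF _ F'[OF t]])
        (simp add: F_def u_periodic[OF I_D[OF t]] p1_periodic[OF t])
    have W_periodic: "W t (x + L) = W t x" for x
      by (simp add: W_def u_periodic[OF I_D[OF t]] ut_periodic[OF t])
    obtain l where "x + of_int l * L \<in> {0..<L}"
      using periodic_representative[OF \<open>L > 0\<close>] by metis
    then have "F' t (x + of_int l * L) = W t (x + of_int l * L)"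
      using inner zero by (cases "x + of_int l * L = 0") auto
    then show ?thesis
      using periodic_int[of "F' t", OF F'_periodic] periodic_int[of "W t", OF W_periodic] by simp
  qed
  have F_W: "(F t has_real_derivative W t x) (at x)" if "t \<in> I" for t x
    using F'[OF that, of x] F'_eq[OF that] by simp
  have F3: "bounded_derivs 3 I F"
    unfolding numeral_3_eq_3 using bounded_derivs_SucI[OF F1 F_W W2] by (simp add: numeral_2_eq_2)

  \<comment> \<open>the gain of two derivatives of the pressure from the equation: \<open>p\<^sub>x = F / M(u) - 1\<close>\<close>
  have p1_3: "bounded_derivs 3 I p1"
  proof -
    have "continuous_on {0<..} M"
      by (rule C_k_on_imp_continuous_on[OF M(1)])
    then obtain c where c: "c > 0" "\<And>s. s \<in> {a..b} \<Longrightarrow> c \<le> M s"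
      using continuous_positive_bound[of "{0<..}" M "{a..b}"] sub M(2) by (metis compact_Icc greaterThan_iff subsetD)
    have "bounded_derivs 4 I (\<lambda>t x. 1 / M (u x t))"
      by (rule bounded_derivs_inverse[OF Mu c(1) c(2)[OF range]])
    then have "bounded_derivs 3 I (\<lambda>t x. 1 / M (u x t))"
      by (rule bounded_derivs_mono) simp
    then have "bounded_derivs 3 I (\<lambda>t x. F t x * (1 / M (u x t)) - 1)"
      by (intro bounded_derivs_diff bounded_derivs_mult F3 bounded_derivs_const[where K = 1]) simp_all
    then show ?thesis
    proof (rule bounded_derivs_cong)
      fix t x assume t: "t \<in> I"
      then have "M (u x t) > 0"
        using M(2) u_pos I_D by blast
      then show "F t x * (1 / M (u x t)) - 1 = p1 t x"
        by (simp add: F_def)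
    qed
  qed

  \<comment> \<open>from here on an index is a pair of mesh width and time\<close>
  define J where "J = {0<..L} \<times> I"
  have J: "fst i > 0" "fst i \<le> L" "snd i \<in> I" if "i \<in> J" for i
    using that by (auto simp: J_def)
  have h_bound: "bounded_derivs k J (\<lambda>i x. (fst i)\<^sup>2)" for k
    by (rule bounded_derivs_const[where K = "L\<^sup>2"]) (use J in \<open>force intro: power_mono\<close>)
  have on_J: "bounded_derivs k J (\<lambda>i. f (snd i))" if "bounded_derivs k I f" for k and f :: "real \<Rightarrow> real \<Rightarrow> real"
    using that J(3) by (rule bounded_derivs_reindex)
  let ?u = "\<lambda>i x. u x (snd i)"

  define e where "e i x = (m (?u i (x - fst i / 2)) (?u i (x + fst i / 2)) - M (?u i x)) / (fst i)\<^sup>2" for i x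
  have e1: "bounded_derivs 1 J e"
    unfolding e_def
  proof (rule midpoint_accurate_expansion[OF mid[OF \<open>a > 0\<close>, of b] \<open>a > 0\<close> M'(1)])
    show "C_k_on (Suc 2) M' {0<..}"
      using M'(2) by (simp add: numeral_3_eq_3 numeral_2_eq_2)
    show "bounded_derivs 3 J ?u"
      by (rule on_J[OF u_le]) simp
  qed (use J range in auto)

  \<comment> \<open>the remainder of the iterated central difference, split so that each summand is an error of
    a single central difference\<close>
  define \<phi> where "\<phi> i x = cdiff (fst i) (\<lambda>x. (cdiff (fst i) (?u i) x - u1 (snd i) x) / (fst i)\<^sup>2) x
      + (cdiff (fst i) (u1 (snd i)) x - u2 (snd i) x) / (fst i)\<^sup>2" for i x
  have \<phi>2: "bounded_derivs 2 J \<phi>"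
    unfolding \<phi>_def
  proof (rule bounded_derivs_add)
    have "bounded_derivs 3 J (\<lambda>i x. (cdiff (fst i) (?u i) x - u1 (snd i) x) / (fst i)\<^sup>2)"
      by (rule bounded_derivs_cdiff_error) (use on_J[OF u1(2)] J u1(1) in auto)
    then show "bounded_derivs 2 J (\<lambda>i. cdiff (fst i) (\<lambda>x. (cdiff (fst i) (?u i) x - u1 (snd i) x) / (fst i)\<^sup>2))"
      using J(1) by (intro bounded_derivs_cdiff) (simp_all add: numeral_3_eq_3 numeral_2_eq_2)
    show "bounded_derivs 2 J (\<lambda>i x. (cdiff (fst i) (u1 (snd i)) x - u2 (snd i) x) / (fst i)\<^sup>2)"
      by (rule bounded_derivs_cdiff_error) (use on_J[OF u2(2)] J u2(1) in auto)
  qed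
  have second_difference: "cdiff (fst i) (cdiff (fst i) (?u i)) x = u2 (snd i) x + (fst i)\<^sup>2 * \<phi> i x"
    if "i \<in> J" for i x
    using J(1)[OF that] unfolding \<phi>_def by (simp add: cdiff_linear flip: add_divide_distrib)

  define \<epsilon> where "\<epsilon> i x = (cdiff (fst i) (p (snd i)) x - p1 (snd i) x) / (fst i)\<^sup>2 + cdiff (fst i) (\<phi> i) x" for i x
  have \<epsilon>1: "bounded_derivs 1 J \<epsilon>"
    unfolding \<epsilon>_def
  proof (rule bounded_derivs_add)
    show "bounded_derivs 1 J (\<lambda>i x. (cdiff (fst i) (p (snd i)) x - p1 (snd i) x) / (fst i)\<^sup>2)"
      by (rule bounded_derivs_cdiff_error) (use on_J[OF p1_3] J p1(1) in \<open>auto simp: numeral_3_eq_3 numeral_2_eq_2\<close>)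
    show "bounded_derivs 1 J (\<lambda>i. cdiff (fst i) (\<phi> i))"
      using J(1) \<phi>2 by (intro bounded_derivs_cdiff) (simp_all add: numeral_2_eq_2)
  qed
  let ?P = "\<lambda>i z. cdiff (fst i) (cdiff (fst i) (?u i)) z - Zp (?u i z) - Zm (?u i z)"
  have pressure_gradient: "cdiff (fst i) (?P i) x = p1 (snd i) x + (fst i)\<^sup>2 * \<epsilon> i x" if "i \<in> J" for i x
  proof -
    have "?P i = (\<lambda>z. p (snd i) z + (fst i)\<^sup>2 * \<phi> i z)"
      by (simp add: second_difference[OF that] p_def fun_eq_iff)
    then show ?thesis
      using J(1)[OF that] unfolding \<epsilon>_def by (simp add: cdiff_linear distrib_left)
  qed

  define \<rho> where "\<rho> i x = e i x * (1 + p1 (snd i) x) + M (?u i x) * \<epsilon> i x + (fst i)\<^sup>2 * (e i x * \<epsilon> i x)" for i x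
  have \<rho>1: "bounded_derivs 1 J \<rho>"
  proof -
    have slope: "bounded_derivs 1 J (\<lambda>i x. 1 + p1 (snd i) x)"
      by (rule bounded_derivs_add[OF bounded_derivs_const[where c = "\<lambda>i. 1" and K = 1] on_J[OF p1(2)]]) simp
    have mobility: "bounded_derivs 1 J (\<lambda>i x. M (?u i x))"
      by (rule bounded_derivs_mono[OF on_J[OF Mu]]) simp
    show ?thesis
      unfolding \<rho>_def
      by (rule bounded_derivs_add[OF bounded_derivs_add[OF bounded_derivs_mult[OF e1 slope]
            bounded_derivs_mult[OF mobility \<epsilon>1]] bounded_derivs_mult[OF h_bound bounded_derivs_mult[OF e1 \<epsilon>1]]])
  qed
  define q where "q i x = (cdiff (fst i) (F (snd i)) x - W (snd i) x) / (fst i)\<^sup>2 + cdiff (fst i) (\<rho> i) x" for i x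
  have q0: "bounded_derivs 0 J q"
    unfolding q_def
  proof (rule bounded_derivs_add)
    show "bounded_derivs 0 J (\<lambda>i x. (cdiff (fst i) (F (snd i)) x - W (snd i) x) / (fst i)\<^sup>2)"
    proof (rule bounded_derivs_cdiff_error)
      show "bounded_derivs (0 + 2) J (\<lambda>i. W (snd i))"
        using on_J[OF W2] by (simp only: add_0)
    qed (use J F_W in auto)
    show "bounded_derivs 0 J (\<lambda>i. cdiff (fst i) (\<rho> i))"
      using J(1) \<rho>1 by (intro bounded_derivs_cdiff) simp_all
  qed
  have flux: "cdiff (fst i) (\<lambda>y. m (?u i (y - fst i / 2)) (?u i (y + fst i / 2)) * (1 + cdiff (fst i) (?P i) y)) x
      = W (snd i) x + (fst i)\<^sup>2 * q i x" if i: "i \<in> J" for i x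
  proof -
    have "m (?u i (y - fst i / 2)) (?u i (y + fst i / 2)) * (1 + cdiff (fst i) (?P i) y)
        = F (snd i) y + (fst i)\<^sup>2 * \<rho> i y" for y
    proof -
      have "m (?u i (y - fst i / 2)) (?u i (y + fst i / 2)) = M (?u i y) + (fst i)\<^sup>2 * e i y"
        using J(1)[OF i] by (simp add: e_def)
      then show ?thesis
        unfolding pressure_gradient[OF i] F_def \<rho>_def by (simp add: algebra_simps)
    qed
    then show ?thesis
      using J(1)[OF i] unfolding q_def by (simp add: cdiff_linear distrib_left)
  qed
  obtain K where K: "\<And>i x. i \<in> J \<Longrightarrow> \<bar>q i x\<bar> \<le> K"
    using bounded_derivs_bound[OF q0] by metis
  show ?thesis
    unfolding second_order_consistent_def
  proof (intro exI[of _ K] allI impI ballI)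
    fix N :: nat and j t
    assume N: "N > 0" and t: "t \<in> {0<..<T}"
    define h where "h = L / real N"
    have h: "h > 0" "h \<le> L"
      using N \<open>L > 0\<close> by (auto simp: h_def divide_le_eq mult_le_cancel_left1)
    then have i: "(h, t) \<in> J"
      using t by (simp add: J_def I_def)
    have t': "t \<in> I" using t by (simp add: I_def)
    have "truncation_error \<alpha> Zp Zm m h u j t = h\<^sup>2 * q (h, t) (of_int j * h)"
      unfolding truncation_error_cdiff[OF h(1)] using flux[OF i, of "of_int j * h"] DERIV_imp_deriv[OF ut[OF t']]
      by (simp add: W_def)
    then show "\<bar>truncation_error \<alpha> Zp Zm m (L / real N) u j t\<bar> \<le> K * (L / real N)\<^sup>2"
      unfolding h_def[symmetric] using mult_left_mono[OF K[OF i], of "h\<^sup>2"] by (simp add: abs_mult mult.commute)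
  qed
qed

theorem theorem4p3:
  fixes L T \<alpha> :: real
    and M Zp Zm u0 :: "real \<Rightarrow> real"
    and u :: "real \<Rightarrow> real \<Rightarrow> real"
  assumes "L > 0" and "T > 0" and "\<alpha> \<ge> 0"
    and "continuous_on {0..} M" and "C_k_on 4 M {0<..}"
    and "\<forall>s\<ge>0. M s \<ge> 0" and "\<forall>s>0. M s > 0"
    and "C_k_on 2 Zp {0<..}" and "\<forall>s>0. deriv Zp s \<ge> 0"
    and "C_k_on 2 Zm {0<..}" and "\<forall>s>0. deriv Zm s \<le> 0"
    and "\<forall>x. u0 x > 0"
    and "smooth_solution_P L T \<alpha> M Zp Zm u0 u"
  shows "(\<forall>m. GM_mobility M m \<longrightarrow> second_order_consistent L T \<alpha> Zp Zm m u) \<and>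
         second_order_consistent L T \<alpha> Zp Zm (BEM_mobility M) u"
proof -
  have four: "4 = Suc 3" by simp
  obtain M' where M': "\<And>s. s \<in> {0<..} \<Longrightarrow> (M has_real_derivative M' s) (at s)" "C_k_on 3 M' {0<..}"
    using C_k_on_real_deriv[OF \<open>C_k_on 4 M {0<..}\<close>[unfolded four]] by metis
  have M'_deriv: "(M has_real_derivative M' s) (at s)" if "s > 0" for s
    using M'(1) that by simp
  have consistent: "second_order_consistent L T \<alpha> Zp Zm m u"
    if "\<And>a b. a > 0 \<Longrightarrow> midpoint_accurate a b M M' m" for m
    by (rule midpoint_accurate_imp_second_order_consistent[OF \<open>L > 0\<close> \<open>C_k_on 4 M {0<..}\<close>
          _ M'_deriv M'(2) \<open>C_k_on 2 Zp {0<..}\<close> \<open>C_k_on 2 Zm {0<..}\<close> \<open>smooth_solution_P L T \<alpha> M Zp Zm u0 u\<close> that])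
      (use \<open>\<forall>s>0. M s > 0\<close> in auto)
  have "second_order_consistent L T \<alpha> Zp Zm m u" if "GM_mobility M m" for m
    by (rule consistent[OF GM_midpoint_accurate[OF that _ M'_deriv]])
  moreover have "second_order_consistent L T \<alpha> Zp Zm (BEM_mobility M) u"
    by (rule consistent[OF BEM_midpoint_accurate[OF _ _ M'_deriv M'(2)]]) (use \<open>\<forall>s>0. M s > 0\<close> in auto)
  ultimately show ?thesis by blast
qed


end
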